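(* Let $X$ be a Köthe function space on a $\sigma$-finite measure space $(\Omega,\mu)$, with Fatou norm, and let $\varepsilon\ge 0$. If $T:X\to X$ is an $\varepsilon$-band preserving linear map, then $T$ is continuous.
   Context: A Köthe function space on a $\sigma$-finite measure space $(\Omega,\Sigma,\mu)$ is a Banach space $X$ consisting of equivalence classes, modulo equality almost everywhere, of locally integrable functions on $\Omega$ such that: (i) if $|f(\omega)|\le|g(\omega)|$ a.e. on $\Omega$ with $f$ $\Sigma$-measurable and $g\in X$, then $f\in X$ and $\|f\|\le\|g\|$; (ii) if $S\in\Sigma$ and $\mu(S)\in(0,\infty)$, then $\chi_S\in X$. It is a Banach lattice under the a.e. pointwise order. A Banach lattice $X$ has Fatou norm if there is a constant $\mathfrak{f}$ such that for any non-negative increasing net $(x_i)\subset X$ with $\sup_i\|x_i\|<\infty$ and such that $\bigvee_i x_i$ exists in $X$, one has $\|\bigvee_i x_i\|\le\mathfrak{f}\sup_i\|x_i\|$. A (not necessarily bounded) linear map $T:X\to X$ is $\varepsilon$-band preserving ($\varepsilon$-BP) if for every $x\in X$, $\sup\{\||Tx|\wedge y\| : y\ge 0,\ y\perp x\}\le\varepsilon\|x\|$. *)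

theory Defs
  imports "HOL-Analysis.Analysis"
begin

definition ae_rel :: "'a measure \<Rightarrow> (('a \<Rightarrow> real) \<times> ('a \<Rightarrow> real)) set" where
  "ae_rel M = {(f, g). f \<in> borel_measurable M \<and> g \<in> borel_measurable M \<and> (AE \<omega> in M. f \<omega> = g \<omega>)}"

definition L0 :: "'a measure \<Rightarrow> ('a \<Rightarrow> real) set set" where
  "L0 M = borel_measurable M // ae_rel M"

definition ae_class :: "'a measure \<Rightarrow> ('a \<Rightarrow> real) \<Rightarrow> ('a \<Rightarrow> real) set" where
  "ae_class M f = ae_rel M `` {f}"

text \<open>Pointwise operations, lifted to classes. All members of the unions coincide as soon as
  the arguments are classes and the operation is Borel; see \<open>ae_map_class\<close> and
  \<open>ae_map2_class\<close> below for the instances that are used.\<close>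

definition ae_map :: "'a measure \<Rightarrow> (real \<Rightarrow> real) \<Rightarrow> ('a \<Rightarrow> real) set \<Rightarrow> ('a \<Rightarrow> real) set" where
  "ae_map M h A = (\<Union>f\<in>A. ae_class M (\<lambda>\<omega>. h (f \<omega>)))"

definition ae_map2 ::
  "'a measure \<Rightarrow> (real \<Rightarrow> real \<Rightarrow> real) \<Rightarrow> ('a \<Rightarrow> real) set \<Rightarrow> ('a \<Rightarrow> real) set \<Rightarrow> ('a \<Rightarrow> real) set" where
  "ae_map2 M h A B = (\<Union>f\<in>A. \<Union>g\<in>B. ae_class M (\<lambda>\<omega>. h (f \<omega>) (g \<omega>)))"

definition ae_zero :: "'a measure \<Rightarrow> ('a \<Rightarrow> real) set" where
  "ae_zero M = ae_class M (\<lambda>_. 0)"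

definition ae_add :: "'a measure \<Rightarrow> ('a \<Rightarrow> real) set \<Rightarrow> ('a \<Rightarrow> real) set \<Rightarrow> ('a \<Rightarrow> real) set" where
  "ae_add M = ae_map2 M (+)"

definition ae_diff :: "'a measure \<Rightarrow> ('a \<Rightarrow> real) set \<Rightarrow> ('a \<Rightarrow> real) set \<Rightarrow> ('a \<Rightarrow> real) set" where
  "ae_diff M = ae_map2 M (-)"

definition ae_scale :: "'a measure \<Rightarrow> real \<Rightarrow> ('a \<Rightarrow> real) set \<Rightarrow> ('a \<Rightarrow> real) set" where
  "ae_scale M c = ae_map M (\<lambda>t. c * t)"

definition ae_abs :: "'a measure \<Rightarrow> ('a \<Rightarrow> real) set \<Rightarrow> ('a \<Rightarrow> real) set" where
  "ae_abs M = ae_map M abs"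

definition ae_inf :: "'a measure \<Rightarrow> ('a \<Rightarrow> real) set \<Rightarrow> ('a \<Rightarrow> real) set \<Rightarrow> ('a \<Rightarrow> real) set" where
  "ae_inf M = ae_map2 M min"

definition ae_le :: "'a measure \<Rightarrow> ('a \<Rightarrow> real) set \<Rightarrow> ('a \<Rightarrow> real) set \<Rightarrow> bool" where
  "ae_le M A B \<longleftrightarrow> (\<exists>f\<in>A. \<exists>g\<in>B. AE \<omega> in M. f \<omega> \<le> g \<omega>)"

lemma equiv_ae_rel: "equiv (borel_measurable M) (ae_rel M)"
proof (rule equivI)
  show "ae_rel M \<subseteq> borel_measurable M \<times> borel_measurable M"
    by (auto simp: ae_rel_def)
  show "refl_on (borel_measurable M) (ae_rel M)"
    by (auto simp: ae_rel_def refl_on_def)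
  show "sym (ae_rel M)"
    by (auto simp: ae_rel_def sym_def elim: AE_mp)
  show "trans (ae_rel M)"
    unfolding ae_rel_def trans_def by (auto elim: eventually_elim2)
qed

lemma ae_class_eq_iff:
  assumes "f \<in> borel_measurable M" "g \<in> borel_measurable M"
  shows "ae_class M f = ae_class M g \<longleftrightarrow> (AE \<omega> in M. f \<omega> = g \<omega>)"
  using eq_equiv_class_iff[OF equiv_ae_rel assms] assms
  by (simp add: ae_class_def ae_rel_def)

lemma mem_ae_class_iff:
  assumes "f \<in> borel_measurable M"
  shows "g \<in> ae_class M f \<longleftrightarrow> g \<in> borel_measurable M \<and> (AE \<omega> in M. f \<omega> = g \<omega>)"
  using assms by (auto simp: ae_class_def ae_rel_def)

lemma ae_class_in_L0: "f \<in> borel_measurable M \<Longrightarrow> ae_class M f \<in> L0 M"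
  unfolding L0_def ae_class_def by (rule quotientI)

lemma L0_E:
  assumes "A \<in> L0 M"
  obtains f where "f \<in> borel_measurable M" "A = ae_class M f"
  using assms unfolding L0_def ae_class_def by (auto elim: quotientE)

lemma ae_map_class:
  assumes h: "h \<in> borel_measurable borel" and f: "f \<in> borel_measurable M"
  shows "ae_map M h (ae_class M f) = ae_class M (\<lambda>\<omega>. h (f \<omega>))"
proof -
  have "ae_class M (\<lambda>\<omega>. h (f' \<omega>)) = ae_class M (\<lambda>\<omega>. h (f \<omega>))" if "f' \<in> ae_class M f" for f'
  proof -
    have f': "f' \<in> borel_measurable M" and ae: "AE \<omega> in M. f \<omega> = f' \<omega>"
      using that f by (auto simp: mem_ae_class_iff)
    have "(\<lambda>\<omega>. h (f \<omega>)) \<in> borel_measurable M" "(\<lambda>\<omega>. h (f' \<omega>)) \<in> borel_measurable M"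
      using measurable_compose[OF f h] measurable_compose[OF f' h] by auto
    moreover have "AE \<omega> in M. h (f' \<omega>) = h (f \<omega>)"
      using ae by eventually_elim simp
    ultimately show ?thesis by (simp add: ae_class_eq_iff)
  qed
  moreover have "f \<in> ae_class M f" using f by (simp add: mem_ae_class_iff)
  ultimately show ?thesis unfolding ae_map_def by blast
qed

lemma ae_map2_class:
  assumes h: "(\<lambda>(s, t). h s t) \<in> borel_measurable (borel \<Otimes>\<^sub>M borel)"
    and f: "f \<in> borel_measurable M" and g: "g \<in> borel_measurable M"
  shows "ae_map2 M h (ae_class M f) (ae_class M g) = ae_class M (\<lambda>\<omega>. h (f \<omega>) (g \<omega>))"
proof -
  have m: "(\<lambda>\<omega>. h (u \<omega>) (v \<omega>)) \<in> borel_measurable M"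
    if "u \<in> borel_measurable M" "v \<in> borel_measurable M" for u v
    using measurable_compose[OF measurable_Pair[OF that] h] by simp
  have "ae_class M (\<lambda>\<omega>. h (f' \<omega>) (g' \<omega>)) = ae_class M (\<lambda>\<omega>. h (f \<omega>) (g \<omega>))"
    if "f' \<in> ae_class M f" "g' \<in> ae_class M g" for f' g'
  proof -
    have f': "f' \<in> borel_measurable M" and ae: "AE \<omega> in M. f \<omega> = f' \<omega>"
      using that f by (auto simp: mem_ae_class_iff)
    have g': "g' \<in> borel_measurable M" and ae': "AE \<omega> in M. g \<omega> = g' \<omega>"
      using that g by (auto simp: mem_ae_class_iff)
    have "AE \<omega> in M. h (f' \<omega>) (g' \<omega>) = h (f \<omega>) (g \<omega>)"
      using ae ae' by eventually_elim simp
    then show ?thesis by (simp add: ae_class_eq_iff m f g f' g')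
  qed
  moreover have "f \<in> ae_class M f" "g \<in> ae_class M g"
    using f g by (simp_all add: mem_ae_class_iff)
  ultimately show ?thesis unfolding ae_map2_def by blast
qed

lemma ae_ops_class:
  assumes f: "f \<in> borel_measurable M" and g: "g \<in> borel_measurable M"
  shows "ae_add M (ae_class M f) (ae_class M g) = ae_class M (\<lambda>\<omega>. f \<omega> + g \<omega>)"
    and "ae_diff M (ae_class M f) (ae_class M g) = ae_class M (\<lambda>\<omega>. f \<omega> - g \<omega>)"
    and "ae_inf M (ae_class M f) (ae_class M g) = ae_class M (\<lambda>\<omega>. min (f \<omega>) (g \<omega>))"
    and "ae_scale M c (ae_class M f) = ae_class M (\<lambda>\<omega>. c * f \<omega>)"
    and "ae_abs M (ae_class M f) = ae_class M (\<lambda>\<omega>. \<bar>f \<omega>\<bar>)"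
  unfolding ae_add_def ae_diff_def ae_inf_def ae_scale_def ae_abs_def
  by (simp_all add: ae_map_class ae_map2_class f g)

lemma ae_le_class:
  assumes f: "f \<in> borel_measurable M" and g: "g \<in> borel_measurable M"
  shows "ae_le M (ae_class M f) (ae_class M g) \<longleftrightarrow> (AE \<omega> in M. f \<omega> \<le> g \<omega>)"
proof
  assume "ae_le M (ae_class M f) (ae_class M g)"
  then obtain f' g' where "AE \<omega> in M. f \<omega> = f' \<omega>" "AE \<omega> in M. g \<omega> = g' \<omega>"
    "AE \<omega> in M. f' \<omega> \<le> g' \<omega>"
    using f g by (auto simp: ae_le_def mem_ae_class_iff)
  then show "AE \<omega> in M. f \<omega> \<le> g \<omega>" by eventually_elim simp
next
  assume "AE \<omega> in M. f \<omega> \<le> g \<omega>"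
  moreover have "f \<in> ae_class M f" "g \<in> ae_class M g"
    using f g by (simp_all add: mem_ae_class_iff)
  ultimately show "ae_le M (ae_class M f) (ae_class M g)"
    unfolding ae_le_def by blast
qed

text \<open>The distance is cut off outside \<open>X\<close> because the library's metric spaces ask for
  non-negativity and symmetry on the whole type.\<close>

definition koethe_dist ::
  "'a measure \<Rightarrow> ('a \<Rightarrow> real) set set \<Rightarrow> (('a \<Rightarrow> real) set \<Rightarrow> real)
    \<Rightarrow> ('a \<Rightarrow> real) set \<Rightarrow> ('a \<Rightarrow> real) set \<Rightarrow> real" where
  "koethe_dist M X N A B = (if A \<in> X \<and> B \<in> X then N (ae_diff M A B) else 0)"

text \<open>Locally integrable means integrable over every measurable set of finite measure.\<close>

locale koethe_function_space = sigma_finite_measure M for M :: "'a measure" +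
  fixes X :: "('a \<Rightarrow> real) set set" and N :: "('a \<Rightarrow> real) set \<Rightarrow> real"
  assumes carrier_subset: "X \<subseteq> L0 M"
    and locally_integrable:
      "\<lbrakk>A \<in> X; f \<in> A; S \<in> sets M; emeasure M S < \<infinity>\<rbrakk> \<Longrightarrow> set_integrable M S f"
    and zero_mem: "ae_zero M \<in> X"
    and add_mem: "\<lbrakk>A \<in> X; B \<in> X\<rbrakk> \<Longrightarrow> ae_add M A B \<in> X"
    and scale_mem: "A \<in> X \<Longrightarrow> ae_scale M c A \<in> X"
    and norm_nonneg: "A \<in> X \<Longrightarrow> 0 \<le> N A"
    and norm_eq_zero_iff: "A \<in> X \<Longrightarrow> N A = 0 \<longleftrightarrow> A = ae_zero M"
    and norm_triangle: "\<lbrakk>A \<in> X; B \<in> X\<rbrakk> \<Longrightarrow> N (ae_add M A B) \<le> N A + N B"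
    and norm_scale: "A \<in> X \<Longrightarrow> N (ae_scale M c A) = \<bar>c\<bar> * N A"
    and complete: "Metric_space.mcomplete X (koethe_dist M X N)"
    and ideal:
      "\<lbrakk>f \<in> borel_measurable M; B \<in> X; g \<in> B; AE \<omega> in M. \<bar>f \<omega>\<bar> \<le> \<bar>g \<omega>\<bar>\<rbrakk>
        \<Longrightarrow> ae_class M f \<in> X \<and> N (ae_class M f) \<le> N B"
    and indicator_mem:
      "\<lbrakk>S \<in> sets M; 0 < emeasure M S; emeasure M S < \<infinity>\<rbrakk> \<Longrightarrow> ae_class M (indicator S) \<in> X"
begin

lemma mem_E:
  assumes "A \<in> X"
  obtains f where "f \<in> borel_measurable M" "A = ae_class M f"
  using assms carrier_subset by (blast elim: L0_E)

lemma diff_eq: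
  assumes "A \<in> X" "B \<in> X"
  shows "ae_diff M A B = ae_add M A (ae_scale M (-1) B)"
proof -
  obtain f g where "f \<in> borel_measurable M" "A = ae_class M f" "g \<in> borel_measurable M" "B = ae_class M g"
    using assms by (meson mem_E)
  then show ?thesis by (simp add: ae_ops_class)
qed

lemma diff_mem: "\<lbrakk>A \<in> X; B \<in> X\<rbrakk> \<Longrightarrow> ae_diff M A B \<in> X"
  by (simp add: diff_eq add_mem scale_mem)

lemma Metric_space_koethe_dist: "Metric_space X (koethe_dist M X N)"
proof
  fix A B C
  show "0 \<le> koethe_dist M X N A B"
    by (simp add: koethe_dist_def diff_mem norm_nonneg)
  show "koethe_dist M X N A B = koethe_dist M X N B A"
  proof (cases "A \<in> X \<and> B \<in> X")
    case True
    then obtain f g where "f \<in> borel_measurable M" "A = ae_class M f"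
      "g \<in> borel_measurable M" "B = ae_class M g"
      by (meson mem_E)
    then have "ae_diff M A B = ae_scale M (-1) (ae_diff M B A)"
      by (simp add: ae_ops_class)
    then have "N (ae_diff M A B) = N (ae_diff M B A)"
      using True by (simp add: norm_scale diff_mem)
    then show ?thesis using True by (simp add: koethe_dist_def)
  qed (auto simp: koethe_dist_def)
  show "koethe_dist M X N A B = 0 \<longleftrightarrow> A = B" if AB: "A \<in> X" "B \<in> X"
  proof -
    obtain f g where fg: "f \<in> borel_measurable M" "A = ae_class M f"
      "g \<in> borel_measurable M" "B = ae_class M g"
      using AB by (meson mem_E)
    have "koethe_dist M X N A B = 0 \<longleftrightarrow> ae_diff M A B = ae_zero M"
      using AB by (simp add: koethe_dist_def norm_eq_zero_iff diff_mem)
    also have "\<dots> \<longleftrightarrow> A = B"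
      using fg by (simp add: ae_ops_class ae_zero_def ae_class_eq_iff)
    finally show ?thesis .
  qed
  show "koethe_dist M X N A C \<le> koethe_dist M X N A B + koethe_dist M X N B C"
    if ABC: "A \<in> X" "B \<in> X" "C \<in> X"
  proof -
    obtain f g h where "f \<in> borel_measurable M" "A = ae_class M f"
      "g \<in> borel_measurable M" "B = ae_class M g" "h \<in> borel_measurable M" "C = ae_class M h"
      using ABC by (meson mem_E)
    then have "ae_diff M A C = ae_add M (ae_diff M A B) (ae_diff M B C)"
      by (simp add: ae_ops_class)
    then show ?thesis
      using ABC by (simp add: koethe_dist_def norm_triangle diff_mem)
  qed
qed

lemma abs_mem:
  assumes "A \<in> X" shows "ae_abs M A \<in> X"
proof -
  obtain f where f: "f \<in> borel_measurable M" "A = ae_class M f"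
    using assms by (meson mem_E)
  have "ae_class M (\<lambda>\<omega>. \<bar>f \<omega>\<bar>) \<in> X"
    using ideal[of "\<lambda>\<omega>. \<bar>f \<omega>\<bar>" A f] f assms by (simp add: mem_ae_class_iff)
  then show ?thesis using f by (simp add: ae_ops_class)
qed

lemma inf_mem:
  assumes AB: "A \<in> X" "B \<in> X" shows "ae_inf M A B \<in> X"
proof -
  obtain f g where fg: "f \<in> borel_measurable M" "A = ae_class M f"
    "g \<in> borel_measurable M" "B = ae_class M g"
    using AB by (meson mem_E)
  let ?s = "\<lambda>\<omega>. \<bar>f \<omega>\<bar> + \<bar>g \<omega>\<bar>"
  have "ae_class M ?s = ae_add M (ae_abs M A) (ae_abs M B)"
    using fg by (simp add: ae_ops_class)
  then have "ae_class M ?s \<in> X"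
    using AB by (simp add: add_mem abs_mem)
  then have "ae_class M (\<lambda>\<omega>. min (f \<omega>) (g \<omega>)) \<in> X"
    using ideal[of "\<lambda>\<omega>. min (f \<omega>) (g \<omega>)" "ae_class M ?s" ?s] fg
    by (auto simp: mem_ae_class_iff min_def)
  then show ?thesis using fg by (simp add: ae_ops_class)
qed

text \<open>\<^const>\<open>ae_inf\<close> and \<^const>\<open>ae_abs\<close> are the lattice operations of the ordered set \<open>X\<close>.\<close>

lemma inf_is_glb:
  assumes "A \<in> X" "B \<in> X" "C \<in> X"
  shows "ae_le M C (ae_inf M A B) \<longleftrightarrow> ae_le M C A \<and> ae_le M C B"
proof -
  obtain f g h where "f \<in> borel_measurable M" "A = ae_class M f"
    "g \<in> borel_measurable M" "B = ae_class M g" "h \<in> borel_measurable M" "C = ae_class M h"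
    using assms by (meson mem_E)
  then show ?thesis by (simp add: ae_ops_class ae_le_class)
qed

lemma abs_is_lub:
  assumes "A \<in> X" "C \<in> X"
  shows "ae_le M (ae_abs M A) C \<longleftrightarrow> ae_le M A C \<and> ae_le M (ae_scale M (-1) A) C"
proof -
  obtain f h where "f \<in> borel_measurable M" "A = ae_class M f"
    "h \<in> borel_measurable M" "C = ae_class M h"
    using assms by (meson mem_E)
  then show ?thesis by (simp add: ae_ops_class ae_le_class abs_le_iff)
qed

end

definition increasing_net_on ::
  "'i set \<Rightarrow> ('i \<Rightarrow> 'i \<Rightarrow> bool) \<Rightarrow> ('v \<Rightarrow> 'v \<Rightarrow> bool) \<Rightarrow> ('i \<Rightarrow> 'v) \<Rightarrow> bool" where
  "increasing_net_on I r le x \<longleftrightarrow>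
     I \<noteq> {} \<and> (\<forall>i\<in>I. r i i) \<and> (\<forall>i\<in>I. \<forall>j\<in>I. \<forall>k\<in>I. r i j \<longrightarrow> r j k \<longrightarrow> r i k) \<and>
     (\<forall>i\<in>I. \<forall>j\<in>I. \<exists>k\<in>I. r i k \<and> r j k) \<and>
     (\<forall>i\<in>I. \<forall>j\<in>I. r i j \<longrightarrow> le (x i) (x j))"

definition is_lub_in :: "'v set \<Rightarrow> ('v \<Rightarrow> 'v \<Rightarrow> bool) \<Rightarrow> 'v set \<Rightarrow> 'v \<Rightarrow> bool" where
  "is_lub_in X le D s \<longleftrightarrow>
     s \<in> X \<and> (\<forall>d\<in>D. le d s) \<and> (\<forall>u\<in>X. (\<forall>d\<in>D. le d u) \<longrightarrow> le s u)"

text \<open>A definition cannot quantify over index types. The nets here are indexed by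
  directed sets of elements of the type of the space itself; \<open>fatou_norm_on_net\<close> below
  shows that this covers nets over every index type.\<close>

definition fatou_norm_on ::
  "'v set \<Rightarrow> ('v \<Rightarrow> 'v \<Rightarrow> bool) \<Rightarrow> 'v \<Rightarrow> ('v \<Rightarrow> real) \<Rightarrow> bool" where
  "fatou_norm_on X le z N \<longleftrightarrow>
     (\<exists>c::real. \<forall>(I::'v set) r x s.
        increasing_net_on I r le x \<longrightarrow> x ` I \<subseteq> X \<longrightarrow> (\<forall>i\<in>I. le z (x i)) \<longrightarrow>
        bdd_above ((\<lambda>i. N (x i)) ` I) \<longrightarrow> is_lub_in X le (x ` I) s \<longrightarrow>
        N s \<le> c * (SUP i\<in>I. N (x i)))"

lemma fatou_norm_on_net:
  fixes X :: "'v set"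
  assumes "fatou_norm_on X le z N"
    and refl: "\<And>u. u \<in> X \<Longrightarrow> le u u"
    and trans: "\<And>u v w. \<lbrakk>u \<in> X; v \<in> X; w \<in> X; le u v; le v w\<rbrakk> \<Longrightarrow> le u w"
  shows "\<exists>c::real. \<forall>(I::'i set) r x s.
        increasing_net_on I r le x \<longrightarrow> x ` I \<subseteq> X \<longrightarrow> (\<forall>i\<in>I. le z (x i)) \<longrightarrow>
        bdd_above ((\<lambda>i. N (x i)) ` I) \<longrightarrow> is_lub_in X le (x ` I) s \<longrightarrow>
        N s \<le> c * (SUP i\<in>I. N (x i))"
proof -
  obtain c :: real where c: "\<And>(J::'v set) q y s.
      \<lbrakk>increasing_net_on J q le y; y ` J \<subseteq> X; \<forall>j\<in>J. le z (y j);
       bdd_above ((\<lambda>j. N (y j)) ` J); is_lub_in X le (y ` J) s\<rbrakk>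
      \<Longrightarrow> N s \<le> c * (SUP j\<in>J. N (y j))"
    using assms(1) unfolding fatou_norm_on_def by metis
  show ?thesis
  proof (intro exI[of _ c] allI impI)
    fix I :: "'i set" and r x s
    assume net: "increasing_net_on I r le x" and X: "x ` I \<subseteq> X" and pos: "\<forall>i\<in>I. le z (x i)"
      and bdd: "bdd_above ((\<lambda>i. N (x i)) ` I)" and lub: "is_lub_in X le (x ` I) s"
    have "\<exists>w\<in>x ` I. le u w \<and> le v w" if "u \<in> x ` I" "v \<in> x ` I" for u v
      using net that unfolding increasing_net_on_def by blast
    moreover have "le u w" if "u \<in> x ` I" "v \<in> x ` I" "w \<in> x ` I" "le u v" "le v w" for u v w
      using trans[of u v w] that X by blast
    moreover have "le u u" if "u \<in> x ` I" for u
      using refl that X by blast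
    moreover have "x ` I \<noteq> {}"
      using net unfolding increasing_net_on_def by blast
    ultimately have "increasing_net_on (x ` I) le le (\<lambda>v. v)"
      unfolding increasing_net_on_def by blast
    from c[OF this] X pos bdd lub
    show "N s \<le> c * (SUP i\<in>I. N (x i))" by (simp add: image_image)
  qed
qed

definition koethe_fatou_norm ::
  "'a measure \<Rightarrow> ('a \<Rightarrow> real) set set \<Rightarrow> (('a \<Rightarrow> real) set \<Rightarrow> real) \<Rightarrow> bool" where
  "koethe_fatou_norm M X N \<longleftrightarrow> fatou_norm_on X (ae_le M) (ae_zero M) N"

definition koethe_linear ::
  "'a measure \<Rightarrow> ('a \<Rightarrow> real) set set \<Rightarrow> (('a \<Rightarrow> real) set \<Rightarrow> ('a \<Rightarrow> real) set) \<Rightarrow> bool" where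
  "koethe_linear M X T \<longleftrightarrow>
     T \<in> X \<rightarrow> X \<and>
     (\<forall>A\<in>X. \<forall>B\<in>X. T (ae_add M A B) = ae_add M (T A) (T B)) \<and>
     (\<forall>c. \<forall>A\<in>X. T (ae_scale M c A) = ae_scale M c (T A))"

definition ae_disjoint :: "'a measure \<Rightarrow> ('a \<Rightarrow> real) set \<Rightarrow> ('a \<Rightarrow> real) set \<Rightarrow> bool" where
  "ae_disjoint M A B \<longleftrightarrow> ae_inf M (ae_abs M A) (ae_abs M B) = ae_zero M"

text \<open>The supremum is over a non-empty set (it contains the value at \<open>0\<close>) that is bounded by
  the norm of \<open>T A\<close>; see \<open>band_preserving_values_bdd\<close>.\<close>

definition band_preserving_upto ::
  "'a measure \<Rightarrow> ('a \<Rightarrow> real) set set \<Rightarrow> (('a \<Rightarrow> real) set \<Rightarrow> real) \<Rightarrow> real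
    \<Rightarrow> (('a \<Rightarrow> real) set \<Rightarrow> ('a \<Rightarrow> real) set) \<Rightarrow> bool" where
  "band_preserving_upto M X N \<epsilon> T \<longleftrightarrow>
     (\<forall>A\<in>X. (SUP B\<in>{B \<in> X. ae_le M (ae_zero M) B \<and> ae_disjoint M B A}.
               N (ae_inf M (ae_abs M (T A)) B)) \<le> \<epsilon> * N A)"

lemma (in koethe_function_space) band_preserving_values_bdd:
  assumes "C \<in> X" "B \<in> X" "ae_le M (ae_zero M) B"
  shows "N (ae_inf M (ae_abs M C) B) \<le> N C"
proof -
  obtain f g where fg: "f \<in> borel_measurable M" "C = ae_class M f"
    "g \<in> borel_measurable M" "B = ae_class M g"
    using assms by (meson mem_E)
  have "AE \<omega> in M. 0 \<le> g \<omega>"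
    using assms(3) fg by (simp add: ae_zero_def ae_le_class)
  then have "AE \<omega> in M. \<bar>min \<bar>f \<omega>\<bar> (g \<omega>)\<bar> \<le> \<bar>f \<omega>\<bar>"
    by eventually_elim auto
  then have "N (ae_class M (\<lambda>\<omega>. min \<bar>f \<omega>\<bar> (g \<omega>))) \<le> N C"
    using ideal[of "\<lambda>\<omega>. min \<bar>f \<omega>\<bar> (g \<omega>)" C f] fg assms(1) by (simp add: mem_ae_class_iff)
  then show ?thesis using fg by (simp add: ae_ops_class)
qed

definition koethe_topology ::
  "'a measure \<Rightarrow> ('a \<Rightarrow> real) set set \<Rightarrow> (('a \<Rightarrow> real) set \<Rightarrow> real) \<Rightarrow> ('a \<Rightarrow> real) set topology" where
  "koethe_topology M X N = Metric_space.mtopology X (koethe_dist M X N)"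

end

theory Submission
  imports Defs
begin

text \<open>
  Almost band preservation says that \<open>T\<close> restricted to functions living on \<open>S\<close> is off-diagonally
  bounded by \<open>\<epsilon>\<close>. Call \<open>S\<close> good if \<open>T\<close> is bounded on the functions living on \<open>S\<close>. By a gliding hump
  argument the bounds cannot grow quickly along a disjoint sequence of sets; in particular no
  disjoint sequence consists of bad sets. Together with the Fatou property this shows that an
  increasing union of good sets is good. So there is a good set \<open>D\<close> whose complement contains only
  null sets and bad sets. If that complement were bad, it would contain a bad set that does not
  split into two bad ones, hence an atom; but the functions on an atom form a space of dimension
  at most one, on which \<open>T\<close> is bounded.
\<close>

section \<open>Restriction to sets, atoms and exhaustion\<close>

definition restr :: "'a set \<Rightarrow> ('a \<Rightarrow> real) \<Rightarrow> 'a \<Rightarrow> real" where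
  "restr S f = (\<lambda>\<omega>. indicator S \<omega> * f \<omega>)"

lemma restr_measurable [measurable]:
  "S \<in> sets M \<Longrightarrow> f \<in> borel_measurable M \<Longrightarrow> restr S f \<in> borel_measurable M"
  unfolding restr_def by (intro borel_measurable_times borel_measurable_indicator)

lemma restr_apply: "restr S f \<omega> = (if \<omega> \<in> S then f \<omega> else 0)"
  by (simp add: restr_def)

text \<open>Each sublevel set of \<open>f\<close> inside \<open>B\<close> is null or has null
  complement in \<open>B\<close>. The switch from the first case to the second happens at a single
  threshold, and \<open>f\<close> equals that threshold almost everywhere on
  \<open>B\<close>.\<close>

lemma AE_constant_on_atom:
  fixes f :: "'a \<Rightarrow> real"
  assumes [measurable]: "B \<in> sets M" "f \<in> borel_measurable M"
    and atom: "\<And>S. S \<in> sets M \<Longrightarrow> S \<subseteq> B \<Longrightarrow> S \<in> null_sets M \<or> B - S \<in> null_sets M"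
  shows "\<exists>c. AE \<omega> in M. \<omega> \<in> B \<longrightarrow> f \<omega> = c"
proof (cases "B \<in> null_sets M")
  case True
  then show ?thesis using AE_not_in[OF True] by auto
next
  case False
  define L where "L t = {\<omega> \<in> B. f \<omega> < t}" for t
  define Q where "Q = {t. L t \<in> null_sets M}"
  have "L t = {\<omega> \<in> space M. \<omega> \<in> B \<and> f \<omega> < t}" for t
    using sets.sets_into_space[OF assms(1)] by (auto simp: L_def)
  then have L[measurable, simp]: "L t \<in> sets M" for t by simp
  have mono: "L s \<in> null_sets M" if "s \<le> t" "L t \<in> null_sets M" for s t
  proof (rule null_sets_subset[OF that(2)])
    show "L s \<subseteq> L t" using that(1) by (auto simp: L_def)
  qed simp
  have or: "L t \<in> null_sets M \<or> B - L t \<in> null_sets M" for t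
    by (rule atom[OF L]) (auto simp: L_def)
  \<comment> \<open>If every sublevel set were non-null, the sets \<open>B - L (- n)\<close> would
    all be null; they exhaust \<open>B\<close> because \<open>f\<close> is real-valued. Boundedness
    of \<open>Q\<close> follows in the same way from the sets \<open>L n\<close>.\<close>
  have ne: "Q \<noteq> {}"
  proof
    assume "Q = {}"
    then have "(\<Union>n::nat. B - L (- real n)) \<in> null_sets M"
      using or by (intro null_sets_UN') (auto simp: Q_def)
    moreover have "(\<Union>n::nat. B - L (- real n)) = B"
    proof (intro equalityI subsetI)
      fix \<omega> assume "\<omega> \<in> B"
      moreover obtain n :: nat where "- f \<omega> < real n" using reals_Archimedean2 by blast
      ultimately show "\<omega> \<in> (\<Union>n::nat. B - L (- real n))" by (auto simp: L_def intro!: exI[of _ n])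
    qed auto
    ultimately show False using False by simp
  qed
  have bdd: "bdd_above Q"
  proof -
    have "\<exists>n::nat. L (real n) \<notin> null_sets M"
    proof (rule ccontr)
      assume "\<not> ?thesis"
      then have "(\<Union>n::nat. L (real n)) \<in> null_sets M" by (intro null_sets_UN') auto
      moreover have "(\<Union>n::nat. L (real n)) = B"
        using reals_Archimedean2 by (auto simp: L_def)
      ultimately show False using False by simp
    qed
    then obtain n :: nat where "L (real n) \<notin> null_sets M" by blast
    then show ?thesis
      using mono[of "real n"] by (intro bdd_aboveI[of _ "real n"]) (force simp: Q_def)
  qed
  define c where "c = Sup Q"
  have below: "L t \<in> null_sets M" if "t < c" for t
  proof -
    obtain q where "q \<in> Q" "t < q" using \<open>t < c\<close> less_cSup_iff[OF ne bdd] by (auto simp: c_def)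
    then show ?thesis using mono[of t q] by (simp add: Q_def)
  qed
  have above: "B - L t \<in> null_sets M" if "c < t" for t
  proof -
    have "t \<notin> Q" using cSup_upper[OF _ bdd, of t] that by (auto simp: c_def)
    then show ?thesis using or by (auto simp: Q_def)
  qed
  \<comment> \<open>Levels approaching \<open>c\<close> along a sequence suffice, so only countably
    many null sets are discarded.\<close>
  have "AE \<omega> in M. \<forall>n::nat. \<omega> \<notin> L (c - 1 / real (Suc n)) \<and> \<omega> \<notin> B - L (c + 1 / real (Suc n))"
    unfolding AE_all_countable by (intro allI AE_conjI AE_not_in below above) simp_all
  then have "AE \<omega> in M. \<omega> \<in> B \<longrightarrow> f \<omega> = c"
  proof eventually_elim
    case (elim \<omega>)
    show ?case
    proof
      assume B: "\<omega> \<in> B"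
      have close: "\<bar>f \<omega> - c\<bar> \<le> 1 / real (Suc n)" for n
        using elim[rule_format, of n] B by (auto simp: L_def abs_le_iff not_less simp del: of_nat_Suc)
      show "f \<omega> = c"
      proof (rule ccontr)
        assume "f \<omega> \<noteq> c"
        then obtain n where "1 / real (Suc n) < \<bar>f \<omega> - c\<bar>"
          using reals_Archimedean[of "\<bar>f \<omega> - c\<bar>"] by (auto simp: inverse_eq_divide)
        with close[of n] show False by simp
      qed
    qed
  qed
  then show ?thesis by blast
qed

text \<open>Exhaustion needs a finite measure with the same null sets.\<close>

lemma (in sigma_finite_measure) exists_maximal_set:
  assumes sets: "G \<subseteq> sets M" and ne: "G \<noteq> {}"
    and Un: "\<And>S S'. S \<in> G \<Longrightarrow> S' \<in> G \<Longrightarrow> S \<union> S' \<in> G"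
    and incseq: "\<And>D. range D \<subseteq> G \<Longrightarrow> incseq D \<Longrightarrow> (\<Union>n::nat. D n) \<in> G"
  obtains D where "D \<in> G" "\<And>S. S \<in> G \<Longrightarrow> S \<inter> D = {} \<Longrightarrow> S \<in> null_sets M"
proof -
  obtain h where h[measurable]: "h \<in> borel_measurable M" and fin: "integral\<^sup>N M h \<noteq> \<infinity>"
    and pos: "\<And>x. x \<in> space M \<Longrightarrow> 0 < h x"
    using Ex_finite_integrable_function by auto
  let ?H = "density M h"
  interpret h: finite_measure ?H
    by standard (use fin in \<open>simp add: emeasure_density cong: nn_integral_cong\<close>)
  define s where "s = (SUP S\<in>G. measure ?H S)"
  have bdd: "bdd_above (measure ?H ` G)"
    by (auto intro!: bdd_aboveI[of _ "measure ?H (space M)"] simp: h.bounded_measure[simplified])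
  have "\<exists>S\<in>G. s - 1 / real (Suc n) < measure ?H S" for n
    unfolding s_def using less_cSUP_iff[OF ne bdd, of "s - 1 / real (Suc n)"] by (simp add: s_def)
  then obtain S where S: "\<And>n. S n \<in> G" "\<And>n. s - 1 / real (Suc n) < measure ?H (S n)" by metis
  \<comment> \<open>Finite unions turn the near-maximisers into an increasing sequence inside
    \<open>G\<close>; its union attains the supremum \<open>s\<close>.\<close>
  define D where "D n = (\<Union>k\<le>n. S k)" for n
  have "D n \<in> G" for n
    by (induction n) (auto simp: D_def atMost_Suc S(1) Un)
  moreover have "incseq D" unfolding D_def by (intro monoI UN_mono) auto
  ultimately have DG: "(\<Union>n. D n) \<in> G" by (intro incseq) auto
  have "s - 1 / real (Suc n) \<le> measure ?H (\<Union>n. D n)" for n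
  proof -
    have "measure ?H (S n) \<le> measure ?H (\<Union>n. D n)"
      using DG sets by (intro h.finite_measure_mono) (auto simp: D_def)
    then show ?thesis using S(2)[of n] by simp
  qed
  then have sD: "s \<le> measure ?H (\<Union>n. D n)"
    by (intro LIMSEQ_le_const2[of "\<lambda>n. s - 1 / real (Suc n)" s])
      (use tendsto_diff[OF tendsto_const LIMSEQ_inverse_real_of_nat] in \<open>auto simp: inverse_eq_divide\<close>)
  show thesis
  proof (rule that[OF DG])
    fix S assume S: "S \<in> G" "S \<inter> (\<Union>n. D n) = {}"
    have [measurable]: "S \<in> sets M" using S sets by auto
    \<comment> \<open>A set in \<open>G\<close> disjoint from the maximiser must have
      \<open>?H\<close>-measure zero, since its measure would otherwise push the total above
      \<open>s\<close>. As \<open>h\<close> is positive, it is then null for \<open>M\<close> as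
      well.\<close>
    have "measure ?H (S \<union> (\<Union>n. D n)) = measure ?H S + measure ?H (\<Union>n. D n)"
      using S DG sets by (intro h.finite_measure_Union) auto
    moreover have "measure ?H (S \<union> (\<Union>n. D n)) \<le> s"
      unfolding s_def by (rule cSUP_upper[OF _ bdd]) (rule Un[OF S(1) DG])
    ultimately have "measure ?H S = 0" using sD measure_nonneg[of ?H S] by linarith
    then have "S \<in> null_sets ?H" by (simp add: null_sets_def h.emeasure_eq_measure)
    then have "AE x in M. x \<in> S \<longrightarrow> h x \<le> 0" by (simp add: null_sets_density_iff)
    then have "AE x in M. x \<notin> S" using AE_space by eventually_elim (use pos in fastforce)
    then show "S \<in> null_sets M" by (simp add: AE_iff_null_sets)
  qed
qed

section \<open>Calculus with representatives: norm, series and the Fatou property\<close>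

context koethe_function_space
begin

text \<open>Representatives replace classes so that restrictions and almost everywhere estimates can
  be handled pointwise.\<close>

definition funs :: "('a \<Rightarrow> real) set" where
  "funs = {f \<in> borel_measurable M. ae_class M f \<in> X}"

definition fnorm :: "('a \<Rightarrow> real) \<Rightarrow> real" where
  "fnorm f = N (ae_class M f)"

lemma funs_measurable [measurable_dest]: "f \<in> funs \<Longrightarrow> f \<in> borel_measurable M"
  by (simp add: funs_def)

lemma funs_add: "f \<in> funs \<Longrightarrow> g \<in> funs \<Longrightarrow> (\<lambda>\<omega>. f \<omega> + g \<omega>) \<in> funs"
  using add_mem[of "ae_class M f" "ae_class M g"] by (auto simp: funs_def ae_ops_class)

lemma funs_scale: "f \<in> funs \<Longrightarrow> (\<lambda>\<omega>. c * f \<omega>) \<in> funs"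
  using scale_mem[of "ae_class M f" c] by (auto simp: funs_def ae_ops_class(4)[of f M f])

lemma funs_diff: "f \<in> funs \<Longrightarrow> g \<in> funs \<Longrightarrow> (\<lambda>\<omega>. f \<omega> - g \<omega>) \<in> funs"
  using funs_add[OF _ funs_scale[of g "-1"], of f] by simp

lemma funs_zero: "(\<lambda>\<omega>. 0) \<in> funs"
  using zero_mem by (simp add: funs_def ae_zero_def)

lemma funs_ideal:
  assumes "f \<in> borel_measurable M" "g \<in> funs" "AE \<omega> in M. \<bar>f \<omega>\<bar> \<le> \<bar>g \<omega>\<bar>"
  shows "f \<in> funs"
  using ideal[of f "ae_class M g" g] assms by (auto simp: funs_def mem_ae_class_iff)

lemma fnorm_mono:
  assumes "f \<in> borel_measurable M" "g \<in> funs" "AE \<omega> in M. \<bar>f \<omega>\<bar> \<le> \<bar>g \<omega>\<bar>"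
  shows "fnorm f \<le> fnorm g"
  using ideal[of f "ae_class M g" g] assms by (auto simp: funs_def fnorm_def mem_ae_class_iff)

lemma funs_restr: "f \<in> funs \<Longrightarrow> S \<in> sets M \<Longrightarrow> restr S f \<in> funs"
  by (rule funs_ideal[of _ f]) (auto simp: restr_apply)

lemma fnorm_restr_le: "f \<in> funs \<Longrightarrow> S \<in> sets M \<Longrightarrow> fnorm (restr S f) \<le> fnorm f"
  by (rule fnorm_mono) (auto simp: restr_apply)

lemma fnorm_nonneg: "f \<in> funs \<Longrightarrow> 0 \<le> fnorm f"
  by (simp add: funs_def fnorm_def norm_nonneg)

lemma fnorm_scale: "f \<in> funs \<Longrightarrow> fnorm (\<lambda>\<omega>. c * f \<omega>) = \<bar>c\<bar> * fnorm f"
  using norm_scale[of "ae_class M f" c] by (simp add: funs_def fnorm_def ae_ops_class(4)[of f M f])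

lemma fnorm_triangle: "f \<in> funs \<Longrightarrow> g \<in> funs \<Longrightarrow> fnorm (\<lambda>\<omega>. f \<omega> + g \<omega>) \<le> fnorm f + fnorm g"
  using norm_triangle[of "ae_class M f" "ae_class M g"]
  by (simp add: funs_def fnorm_def ae_ops_class)

lemma fnorm_add_le:
  assumes "f \<in> borel_measurable M" "g \<in> funs" "h \<in> funs" "AE \<omega> in M. f \<omega> = g \<omega> + h \<omega>"
  shows "fnorm f \<le> fnorm g + fnorm h"
proof -
  have "fnorm f \<le> fnorm (\<lambda>\<omega>. g \<omega> + h \<omega>)"
    using assms(4) by (intro fnorm_mono assms funs_add) auto
  with fnorm_triangle[OF assms(2,3)] show ?thesis by simp
qed

lemma fnorm_eq_zero_iff: "f \<in> funs \<Longrightarrow> fnorm f = 0 \<longleftrightarrow> (AE \<omega> in M. f \<omega> = 0)"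
  using norm_eq_zero_iff[of "ae_class M f"]
  by (simp add: funs_def fnorm_def ae_zero_def ae_class_eq_iff)

lemma funs_sum: "(\<And>k. k < n \<Longrightarrow> f k \<in> funs) \<Longrightarrow> (\<lambda>\<omega>. \<Sum>k<n. f k \<omega>) \<in> funs" for n :: nat
  by (induction n) (auto intro!: funs_add funs_zero)

lemma fnorm_sum_le:
  "finite I \<Longrightarrow> (\<And>k. k \<in> I \<Longrightarrow> f k \<in> funs) \<Longrightarrow>
    (\<lambda>\<omega>. \<Sum>k\<in>I. f k \<omega>) \<in> funs \<and> fnorm (\<lambda>\<omega>. \<Sum>k\<in>I. f k \<omega>) \<le> (\<Sum>k\<in>I. fnorm (f k))"
proof (induction I rule: finite_induct)
  case empty
  then show ?case using fnorm_eq_zero_iff[OF funs_zero] by (simp add: funs_zero)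
next
  case (insert i I)
  then show ?case
    using fnorm_triangle[of "f i" "\<lambda>\<omega>. \<Sum>k\<in>I. f k \<omega>"] by (auto intro!: funs_add)
qed

lemma koethe_dist_ae_class:
  "f \<in> funs \<Longrightarrow> g \<in> funs \<Longrightarrow>
    koethe_dist M X N (ae_class M f) (ae_class M g) = fnorm (\<lambda>\<omega>. f \<omega> - g \<omega>)"
  by (simp add: koethe_dist_def funs_def fnorm_def ae_ops_class)

lemma mem_carrier_E:
  assumes "A \<in> X"
  obtains f where "f \<in> funs" "A = ae_class M f"
  using assms by (metis (mono_tags, lifting) funs_def mem_Collect_eq mem_E)

text \<open>Completeness enters here: the partial sums are Cauchy because the tail from
  \<open>n\<close> on has norm at most twice \<open>(1/2)^n\<close>.\<close>

lemma geometric_series_converges: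
  fixes f :: "nat \<Rightarrow> 'a \<Rightarrow> real"
  assumes f: "\<And>k. f k \<in> funs" and le: "\<And>k. fnorm (f k) \<le> (1/2)^k"
  obtains g where "g \<in> funs" "(\<lambda>n. fnorm (\<lambda>\<omega>. (\<Sum>k<n. f k \<omega>) - g \<omega>)) \<longlonglongrightarrow> 0"
proof -
  interpret d: Metric_space X "koethe_dist M X N" by (rule Metric_space_koethe_dist)
  define s where "s n = (\<lambda>\<omega>. \<Sum>k<n. f k \<omega>)" for n
  have s: "s n \<in> funs" for n unfolding s_def by (intro funs_sum f)
  have step: "fnorm (\<lambda>\<omega>. s m \<omega> - s n \<omega>) \<le> 2 * (1/2)^n" if "n \<le> m" for m n
  proof -
    have "(\<lambda>\<omega>. s m \<omega> - s n \<omega>) = (\<lambda>\<omega>. \<Sum>k\<in>{n..<m}. f k \<omega>)"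
      using that by (auto simp: s_def sum_diff_nat_ivl lessThan_atLeast0)
    then have "fnorm (\<lambda>\<omega>. s m \<omega> - s n \<omega>) \<le> (\<Sum>k\<in>{n..<m}. fnorm (f k))"
      using fnorm_sum_le[of "{n..<m}" f] f by simp
    also have "\<dots> \<le> (\<Sum>k\<in>{n..<m}. (1/2)^k)" by (intro sum_mono le)
    \<comment> \<open>The induction runs downwards from \<open>n = m\<close>, where the sum is
      empty, and splits off the lowest term.\<close>
    also have "\<dots> \<le> 2 * (1/2)^n"
      using that by (induction rule: inc_induct)
        (auto simp: sum.atLeast_Suc_lessThan)
    finally show ?thesis .
  qed
  have "d.MCauchy (\<lambda>n. ae_class M (s n))"
    unfolding d.MCauchy_def
  proof (intro conjI allI impI)
    show "range (\<lambda>n. ae_class M (s n)) \<subseteq> X" using s by (auto simp: funs_def)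
    fix e :: real assume "0 < e"
    then obtain K where K: "(1/2::real)^K < e/2"
      using real_arch_pow_inv[of "e/2" "1/2"] by auto
    have *: "koethe_dist M X N (ae_class M (s m)) (ae_class M (s n)) < e"
      if "K \<le> n" "n \<le> m" for m n
    proof -
      have "(1/2::real)^n \<le> (1/2)^K" using that by (intro power_decreasing) auto
      then have "fnorm (\<lambda>\<omega>. s m \<omega> - s n \<omega>) < e" using step[OF that(2)] K by linarith
      then show ?thesis by (simp add: koethe_dist_ae_class s)
    qed
    have "koethe_dist M X N (ae_class M (s m)) (ae_class M (s n)) < e"
      if "K \<le> m" "K \<le> n" for m n
      using *[of n m] *[of m n] that by (cases "n \<le> m") (auto simp: d.commute)
    then show "\<exists>K. \<forall>n n'. K \<le> n \<longrightarrow> K \<le> n' \<longrightarrow>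
        koethe_dist M X N (ae_class M (s n)) (ae_class M (s n')) < e" by blast
  qed
  then obtain G where G: "limitin d.mtopology (\<lambda>n. ae_class M (s n)) G sequentially"
    using complete unfolding d.mcomplete_def by blast
  then have "G \<in> X" and lim: "(\<lambda>n. koethe_dist M X N (ae_class M (s n)) G) \<longlonglongrightarrow> 0"
    by (auto simp: d.limitin_metric_dist_null)
  then obtain g where "g \<in> funs" "G = ae_class M g" by (meson mem_carrier_E)
  with lim s that show thesis by (simp add: koethe_dist_ae_class s_def)
qed

text \<open>The moduli of the functions \<open>restr (D n) f\<close> form an increasing net indexed
  by the natural numbers, and the modulus of the restriction to the union is its supremum in
  \<open>X\<close>. Norms are unchanged by passing to the modulus.\<close>

lemma fatou_increasing_restr:
  assumes "koethe_fatou_norm M X N"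
  obtains c where "0 \<le> c"
    "\<And>D f K. \<lbrakk>range D \<subseteq> sets M; incseq D; f \<in> funs; \<And>n. fnorm (restr (D n) f) \<le> K\<rbrakk>
      \<Longrightarrow> fnorm (restr (\<Union>n. D n) f) \<le> c * K"
proof -
  have "u \<in> X \<Longrightarrow> ae_le M u u" for u by (auto elim!: mem_E simp: ae_le_class)
  moreover have "ae_le M u w" if X: "u \<in> X" "v \<in> X" "w \<in> X" and le: "ae_le M u v" "ae_le M v w" for u v w
  proof -
    obtain f g h where "f \<in> borel_measurable M" "u = ae_class M f"
      "g \<in> borel_measurable M" "v = ae_class M g" "h \<in> borel_measurable M" "w = ae_class M h"
      using X by (metis mem_E)
    then show ?thesis using le by (auto simp: ae_le_class)
  qed
  ultimately have "\<exists>c::real. \<forall>(I::nat set) r x s.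
        increasing_net_on I r (ae_le M) x \<longrightarrow> x ` I \<subseteq> X \<longrightarrow> (\<forall>i\<in>I. ae_le M (ae_zero M) (x i)) \<longrightarrow>
        bdd_above ((\<lambda>i. N (x i)) ` I) \<longrightarrow> is_lub_in X (ae_le M) (x ` I) s \<longrightarrow>
        N s \<le> c * (SUP i\<in>I. N (x i))"
    using assms unfolding koethe_fatou_norm_def by (intro fatou_norm_on_net) blast+
  then obtain c0 :: real where c0: "\<And>(I::nat set) r x s.
      \<lbrakk>increasing_net_on I r (ae_le M) x; x ` I \<subseteq> X; \<forall>i\<in>I. ae_le M (ae_zero M) (x i);
        bdd_above ((\<lambda>i. N (x i)) ` I); is_lub_in X (ae_le M) (x ` I) s\<rbrakk>
      \<Longrightarrow> N s \<le> c0 * (SUP i\<in>I. N (x i))"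
    by metis
  show thesis
  \<comment> \<open>The Fatou constant carries no sign; the maximum with 0 makes it monotone to
    replace the supremum of the norms by \<open>K\<close>.\<close>
  proof (rule that[of "max c0 0"])
    fix D :: "nat \<Rightarrow> 'a set" and f K
    assume D: "range D \<subseteq> sets M" "incseq D" and f: "f \<in> funs"
      and K: "\<And>n. fnorm (restr (D n) f) \<le> K"
    have [measurable]: "D n \<in> sets M" "(\<Union>n. D n) \<in> sets M" for n using D by auto
    define g where "g n = (\<lambda>\<omega>. \<bar>restr (D n) f \<omega>\<bar>)" for n
    define h where "h = (\<lambda>\<omega>. \<bar>restr (\<Union>n. D n) f \<omega>\<bar>)"
    have [measurable]: "f \<in> borel_measurable M" using f by measurable
    have [measurable]: "g n \<in> borel_measurable M" "h \<in> borel_measurable M" for n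
      unfolding g_def h_def by measurable
    have gf: "g n \<in> funs" for n
      by (rule funs_ideal[of _ f]) (auto simp: f g_def restr_apply)
    have hf: "h \<in> funs" by (rule funs_ideal[of _ f]) (auto simp: f h_def restr_apply)
    have gK: "N (ae_class M (g n)) \<le> K" for n
      using fnorm_mono[of "g n" "restr (D n) f"] K[of n] f
      by (simp add: fnorm_def[symmetric] g_def funs_restr)
    have "N (ae_class M h) \<le> c0 * (SUP n\<in>UNIV. N (ae_class M (g n)))"
    proof (rule c0[of UNIV "(\<le>)"])
      have "ae_le M (ae_class M (g i)) (ae_class M (g j))" if "i \<le> j" for i j
      proof -
        have "D i \<subseteq> D j" using D(2) that by (auto simp: incseq_def)
        then show ?thesis by (auto simp: ae_le_class g_def restr_apply)
      qed
      then show "increasing_net_on UNIV (\<le>) (ae_le M) (\<lambda>n. ae_class M (g n))"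
        unfolding increasing_net_on_def by (auto intro: max.cobounded1 max.cobounded2)
      show "range (\<lambda>n. ae_class M (g n)) \<subseteq> X" using gf by (auto simp: funs_def)
      show "\<forall>i\<in>UNIV. ae_le M (ae_zero M) (ae_class M (g i))"
        by (auto simp: ae_zero_def ae_le_class g_def)
      show "bdd_above (range (\<lambda>i. N (ae_class M (g i))))"
        using gK by (auto intro!: bdd_aboveI)
      have "ae_le M (ae_class M h) u"
        if "u \<in> X" and u: "\<forall>i. ae_le M (ae_class M (g i)) u" for u
      proof -
        obtain v where v: "v \<in> borel_measurable M" "u = ae_class M v"
          using \<open>u \<in> X\<close> by (meson mem_E)
        have "AE \<omega> in M. \<forall>i. g i \<omega> \<le> v \<omega>"
          using u v by (simp add: ae_le_class AE_all_countable)
        then have "AE \<omega> in M. h \<omega> \<le> v \<omega>"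
        proof eventually_elim
          case (elim \<omega>)
          show ?case
          proof (cases "\<omega> \<in> (\<Union>n. D n)")
            case True
            then obtain n where "\<omega> \<in> D n" by blast
            with True elim[rule_format, of n] show ?thesis by (simp add: g_def h_def restr_apply)
          \<comment> \<open>Off the union \<open>h\<close> is 0, and \<open>v\<close> is
            non-negative there because it dominates \<open>g 0\<close>.\<close>
          next
            case False
            then show ?thesis using elim[rule_format, of 0] by (simp add: g_def h_def restr_apply)
          qed
        qed
        then show ?thesis using v by (simp add: ae_le_class)
      qed
      then show "is_lub_in X (ae_le M) (range (\<lambda>n. ae_class M (g n))) (ae_class M h)"
        using hf unfolding is_lub_in_def by (auto simp: funs_def ae_le_class g_def h_def restr_apply)
    qed
    also have "\<dots> \<le> max c0 0 * (SUP n\<in>UNIV. N (ae_class M (g n)))"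
    proof (rule mult_right_mono)
      show "0 \<le> (SUP n\<in>UNIV. N (ae_class M (g n)))"
        using gf norm_nonneg gK by (intro cSUP_upper2[where x = 0]) (auto simp: funs_def intro!: bdd_aboveI)
    qed simp
    also have "\<dots> \<le> max c0 0 * K" by (intro mult_left_mono cSUP_least) (auto simp: gK)
    finally have "fnorm h \<le> max c0 0 * K" by (simp add: fnorm_def)
    moreover have "fnorm (restr (\<Union>n. D n) f) \<le> fnorm h"
      using hf by (intro fnorm_mono) (auto simp: h_def)
    ultimately show "fnorm (restr (\<Union>n. D n) f) \<le> max c0 0 * K" by simp
  qed simp
qed

end

section \<open>The operator on representatives\<close>

locale almost_band_preserving = koethe_function_space +
  fixes T :: "('a \<Rightarrow> real) set \<Rightarrow> ('a \<Rightarrow> real) set" and \<epsilon> :: real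
  assumes fatou: "koethe_fatou_norm M X N"
    and eps_nonneg: "0 \<le> \<epsilon>"
    and linear: "koethe_linear M X T"
    and band_preserving: "band_preserving_upto M X N \<epsilon> T"
begin

text \<open>The choice depends on \<open>f\<close> only through its class. Hence almost everywhere
  equal arguments give literally the same function, as \<open>Tf_cong\<close> records, while
  linearity holds only almost everywhere.\<close>

definition Tf :: "('a \<Rightarrow> real) \<Rightarrow> 'a \<Rightarrow> real" where
  "Tf f = (SOME g. g \<in> T (ae_class M f))"

lemma
  assumes "f \<in> funs"
  shows Tf_mem: "Tf f \<in> funs" and ae_class_Tf: "ae_class M (Tf f) = T (ae_class M f)"
proof -
  have TX: "T (ae_class M f) \<in> X"
    using linear assms by (auto simp: koethe_linear_def funs_def)
  then obtain g where g: "g \<in> funs" "T (ae_class M f) = ae_class M g" by (meson mem_carrier_E)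
  then have "g \<in> T (ae_class M f)" by (simp add: mem_ae_class_iff funs_def)
  then have "Tf f \<in> T (ae_class M f)" unfolding Tf_def by (rule someI[of "\<lambda>g. g \<in> T (ae_class M f)"])
  then have m: "Tf f \<in> borel_measurable M" and "AE \<omega> in M. g \<omega> = Tf f \<omega>"
    using g by (auto simp: mem_ae_class_iff funs_def)
  then show eq: "ae_class M (Tf f) = T (ae_class M f)"
    using g by (subst g(2), subst ae_class_eq_iff) (auto simp: funs_def)
  show "Tf f \<in> funs" using m eq TX by (simp add: funs_def)
qed

lemma Tf_cong:
  assumes "f \<in> funs" "g \<in> funs" "AE \<omega> in M. f \<omega> = g \<omega>"
  shows "Tf f = Tf g"
proof -
  have "ae_class M f = ae_class M g" using assms by (subst ae_class_eq_iff) (auto simp: funs_def)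
  then show ?thesis by (simp add: Tf_def)
qed

lemma Tf_add:
  assumes f: "f \<in> funs" and g: "g \<in> funs"
  shows "AE \<omega> in M. Tf (\<lambda>\<omega>. f \<omega> + g \<omega>) \<omega> = Tf f \<omega> + Tf g \<omega>"
proof -
  have [measurable]: "f \<in> borel_measurable M" "g \<in> borel_measurable M"
    "Tf f \<in> borel_measurable M" "Tf g \<in> borel_measurable M"
    "Tf (\<lambda>\<omega>. f \<omega> + g \<omega>) \<in> borel_measurable M"
    using f g by (auto intro!: funs_measurable Tf_mem funs_add)
  have "ae_class M (Tf (\<lambda>\<omega>. f \<omega> + g \<omega>)) = T (ae_add M (ae_class M f) (ae_class M g))"
    using f g by (simp add: ae_class_Tf funs_add ae_ops_class)
  also have "\<dots> = ae_add M (ae_class M (Tf f)) (ae_class M (Tf g))"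
    using linear f g by (simp add: koethe_linear_def ae_class_Tf funs_def)
  also have "\<dots> = ae_class M (\<lambda>\<omega>. Tf f \<omega> + Tf g \<omega>)" by (simp add: ae_ops_class)
  finally show ?thesis by (simp add: ae_class_eq_iff)
qed

lemma Tf_scale:
  assumes f: "f \<in> funs"
  shows "AE \<omega> in M. Tf (\<lambda>\<omega>. c * f \<omega>) \<omega> = c * Tf f \<omega>"
proof -
  have [measurable]: "f \<in> borel_measurable M" "Tf f \<in> borel_measurable M"
    "Tf (\<lambda>\<omega>. c * f \<omega>) \<in> borel_measurable M"
    using f by (auto intro!: funs_measurable Tf_mem funs_scale)
  have "ae_class M (Tf (\<lambda>\<omega>. c * f \<omega>)) = T (ae_scale M c (ae_class M f))"
    using f by (simp add: ae_class_Tf funs_scale ae_ops_class(4)[of f M f])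
  also have "\<dots> = ae_scale M c (ae_class M (Tf f))"
    using linear f by (simp add: koethe_linear_def ae_class_Tf funs_def)
  also have "\<dots> = ae_class M (\<lambda>\<omega>. c * Tf f \<omega>)" by (simp add: ae_ops_class(4)[of "Tf f" M "Tf f"])
  finally show ?thesis by (simp add: ae_class_eq_iff)
qed

lemma fnorm_Tf_scale:
  assumes f: "f \<in> funs"
  shows "fnorm (Tf (\<lambda>\<omega>. c * f \<omega>)) = \<bar>c\<bar> * fnorm (Tf f)"
proof -
  have "ae_class M (Tf (\<lambda>\<omega>. c * f \<omega>)) = ae_class M (\<lambda>\<omega>. c * Tf f \<omega>)"
    using Tf_scale[OF f] f
    by (subst ae_class_eq_iff) (auto intro!: funs_measurable Tf_mem funs_scale)
  then show ?thesis using fnorm_scale[OF Tf_mem[OF f]] by (simp add: fnorm_def)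
qed

lemma fnorm_Tf_add_le:
  assumes "f \<in> funs" "g \<in> funs" "h \<in> funs" "AE \<omega> in M. f \<omega> = g \<omega> + h \<omega>"
  shows "fnorm (Tf f) \<le> fnorm (Tf g) + fnorm (Tf h)"
proof -
  have "Tf f = Tf (\<lambda>\<omega>. g \<omega> + h \<omega>)" using assms by (intro Tf_cong funs_add)
  then show ?thesis
    using Tf_add[OF assms(2,3)] assms
    by (intro fnorm_add_le) (auto intro!: funs_measurable Tf_mem funs_add)
qed

lemma Tf_null:
  assumes f: "f \<in> funs" and "AE \<omega> in M. f \<omega> = 0"
  shows "fnorm (Tf f) = 0"
proof -
  have "Tf f = Tf (\<lambda>\<omega>. 0 * f \<omega>)" using assms by (intro Tf_cong funs_scale) auto
  then show ?thesis using fnorm_Tf_scale[OF f, of 0] by simp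
qed

section \<open>Off-diagonal estimate and gliding hump\<close>

text \<open>The modulus of \<open>restr S (Tf f)\<close> is itself an admissible test element: it is
  disjoint from \<open>f\<close>, and its infimum with the modulus of \<open>Tf f\<close> is the
  element itself. All later uses of almost band preservation go through this estimate.\<close>

lemma fnorm_restr_Tf_le:
  assumes f: "f \<in> funs" and S: "S \<in> sets M" and zero: "AE \<omega> in M. \<omega> \<in> S \<longrightarrow> f \<omega> = 0"
  shows "fnorm (restr S (Tf f)) \<le> \<epsilon> * fnorm f"
proof -
  define g where "g = Tf f"
  have g: "g \<in> funs" unfolding g_def by (rule Tf_mem[OF f])
  define b where "b = (\<lambda>\<omega>. \<bar>restr S g \<omega>\<bar>)"
  have [measurable]: "f \<in> borel_measurable M" "g \<in> borel_measurable M" "S \<in> sets M"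
    using f g S by (auto intro: funs_measurable)
  have [measurable]: "b \<in> borel_measurable M" unfolding b_def by measurable
  have b: "b \<in> funs" by (rule funs_ideal[OF _ g]) (auto simp: b_def restr_apply)
  let ?V = "{B \<in> X. ae_le M (ae_zero M) B \<and> ae_disjoint M B (ae_class M f)}"
  have "ae_disjoint M (ae_class M b) (ae_class M f)"
  proof -
    have "AE \<omega> in M. min \<bar>b \<omega>\<bar> \<bar>f \<omega>\<bar> = 0"
      using zero by eventually_elim (auto simp: b_def restr_apply)
    then show ?thesis
      by (simp add: ae_disjoint_def ae_zero_def ae_ops_class(5)[of b M b] ae_ops_class(5)[of f M f]
          ae_ops_class(3) ae_class_eq_iff)
  qed
  then have "ae_class M b \<in> ?V"
    using b by (auto simp: funs_def ae_zero_def ae_le_class b_def)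
  \<comment> \<open>A real supremum dominates its members only once the set of values is known to be
    bounded above.\<close>
  moreover have "bdd_above ((\<lambda>B. N (ae_inf M (ae_abs M (T (ae_class M f))) B)) ` ?V)"
    using band_preserving_values_bdd[of "ae_class M g"] g ae_class_Tf[OF f]
    by (intro bdd_aboveI[of _ "fnorm g"]) (auto simp: g_def funs_def fnorm_def)
  ultimately have "N (ae_inf M (ae_abs M (T (ae_class M f))) (ae_class M b)) \<le>
      (SUP B\<in>?V. N (ae_inf M (ae_abs M (T (ae_class M f))) B))"
    by (rule cSUP_upper)
  also have "\<dots> \<le> \<epsilon> * fnorm f"
    using band_preserving f by (auto simp: band_preserving_upto_def funs_def fnorm_def)
  also have "ae_inf M (ae_abs M (T (ae_class M f))) (ae_class M b) = ae_class M (\<lambda>\<omega>. min \<bar>g \<omega>\<bar> (b \<omega>))"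
    using ae_class_Tf[OF f]
    by (simp add: ae_ops_class(5)[of g M g] ae_ops_class(3) g_def[symmetric] flip: ae_class_Tf[OF f])
  also have "(\<lambda>\<omega>. min \<bar>g \<omega>\<bar> (b \<omega>)) = b" by (auto simp: b_def restr_apply)
  finally have "fnorm b \<le> \<epsilon> * fnorm f" by (simp add: fnorm_def)
  moreover have "fnorm (restr S g) \<le> fnorm b" using b by (intro fnorm_mono) (auto simp: b_def)
  ultimately show ?thesis by (simp add: g_def)
qed

text \<open>The sum \<open>g\<close> of the series satisfies \<open>f k = restr (E k) g\<close>, and almost band preservation
  makes \<open>Tf (f k)\<close> agree on \<open>E k\<close> with \<open>Tf g\<close> up to \<open>\<epsilon> * fnorm g\<close>.\<close>

lemma Tf_bounded_on_disjoint_sequence: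
  fixes E :: "nat \<Rightarrow> 'a set"
  assumes E: "disjoint_family E" "range E \<subseteq> sets M"
    and f: "\<And>k. f k \<in> funs" "\<And>k. fnorm (f k) \<le> (1/2)^k" "\<And>k \<omega>. \<omega> \<notin> E k \<Longrightarrow> f k \<omega> = 0"
  shows "\<exists>C. \<forall>k. fnorm (Tf (f k)) \<le> C"
proof -
  obtain g where g: "g \<in> funs" and lim: "(\<lambda>n. fnorm (\<lambda>\<omega>. (\<Sum>k<n. f k \<omega>) - g \<omega>)) \<longlonglongrightarrow> 0"
    using geometric_series_converges[OF f(1,2)] by blast
  \<comment> \<open>On \<open>E k\<close>, \<open>Tf (f k)\<close> is \<open>Tf g\<close> minus the
    image of \<open>g - f k\<close>; these give the first two terms. The last
    \<open>\<epsilon>\<close> bounds \<open>Tf (f k)\<close> off \<open>E k\<close>, as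
    \<open>f k\<close> has norm at most 1.\<close>
  have "fnorm (Tf (f k)) \<le> fnorm (Tf g) + \<epsilon> * fnorm g + \<epsilon>" for k
  proof -
    have Ek[measurable]: "E k \<in> sets M" using E by auto
    have [measurable]: "g \<in> borel_measurable M" using g by measurable
    have fkm[measurable]: "f k \<in> borel_measurable M" for k using f(1) by measurable
    have eq: "AE \<omega> in M. f k \<omega> = restr (E k) g \<omega>"
    proof -
      let ?d = "\<lambda>\<omega>. f k \<omega> - restr (E k) g \<omega>"
      have d: "?d \<in> funs" by (intro funs_diff f funs_restr g Ek)
      \<comment> \<open>Once \<open>n\<close> exceeds \<open>k\<close>, the partial sum coincides
        with \<open>f k\<close> on \<open>E k\<close>, so the error there is part of the full error
        of the series, which tends to 0.\<close>
      have "fnorm ?d \<le> fnorm (\<lambda>\<omega>. (\<Sum>j<n. f j \<omega>) - g \<omega>)" if "k < n" for n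
      proof (rule fnorm_mono)
        show "(\<lambda>\<omega>. (\<Sum>j<n. f j \<omega>) - g \<omega>) \<in> funs" by (intro funs_diff funs_sum f g)
        have "\<bar>?d \<omega>\<bar> \<le> \<bar>(\<Sum>j<n. f j \<omega>) - g \<omega>\<bar>" for \<omega>
        proof (cases "\<omega> \<in> E k")
          case True
          have "f j \<omega> = 0" if "j \<noteq> k" for j
            using True that E(1) f(3)[of \<omega> j] by (auto simp: disjoint_family_on_def)
          then have "(\<Sum>j<n. f j \<omega>) = (\<Sum>j<n. if j = k then f k \<omega> else 0)"
            by (intro sum.cong) auto
          also have "\<dots> = f k \<omega>" using that by simp
          finally show ?thesis using True by (simp add: restr_apply)
        qed (simp add: restr_apply f)
        then show "AE \<omega> in M. \<bar>?d \<omega>\<bar> \<le> \<bar>(\<Sum>j<n. f j \<omega>) - g \<omega>\<bar>" by simp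
      qed (use d in \<open>simp add: funs_def\<close>)
      then have "fnorm ?d \<le> 0"
        using lim by (intro LIMSEQ_le_const[of _ 0]) (auto intro: exI[of _ "Suc k"])
      then have "fnorm ?d = 0" using fnorm_nonneg[OF d] by simp
      then show ?thesis using fnorm_eq_zero_iff[OF d] by simp
    qed
    \<comment> \<open>The remainder vanishes almost everywhere on \<open>E k\<close>, so its image
      is small on \<open>E k\<close>; its modulus is at most that of \<open>g\<close>.\<close>
    let ?r = "\<lambda>\<omega>. g \<omega> - f k \<omega>"
    have r: "?r \<in> funs" by (intro funs_diff g f)
    have Tr: "AE \<omega> in M. Tf g \<omega> = Tf (f k) \<omega> + Tf ?r \<omega>"
      using Tf_add[OF f(1)[of k] r] by simp
    have mem: "Tf g \<in> funs" "Tf (f k) \<in> funs" "Tf ?r \<in> funs" by (intro Tf_mem g f r)+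
    have co: "space M - E k \<in> sets M" by measurable
    note meas = mem[THEN funs_measurable]
    have "fnorm (Tf (f k)) \<le> fnorm (restr (E k) (Tf (f k))) + fnorm (restr (space M - E k) (Tf (f k)))"
      by (intro fnorm_add_le funs_restr meas mem Ek co) (auto simp: restr_apply intro!: AE_I2)
    also have "fnorm (restr (space M - E k) (Tf (f k))) \<le> \<epsilon> * fnorm (f k)"
      by (intro fnorm_restr_Tf_le f co) (auto simp: f)
    also have "\<epsilon> * fnorm (f k) \<le> \<epsilon>"
    proof -
      have "fnorm (f k) \<le> 1" using f(2)[of k] power_le_one[of "1/2::real" k] by simp
      then show ?thesis using mult_left_mono[OF _ eps_nonneg, of "fnorm (f k)" 1] by simp
    qed
    also have "fnorm (restr (E k) (Tf (f k))) \<le>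
        fnorm (restr (E k) (Tf g)) + fnorm (\<lambda>\<omega>. - 1 * restr (E k) (Tf ?r) \<omega>)"
      using Tr by (intro fnorm_add_le funs_restr funs_scale restr_measurable meas mem Ek)
        (auto simp: restr_apply)
    also have "fnorm (\<lambda>\<omega>. - 1 * restr (E k) (Tf ?r) \<omega>) = fnorm (restr (E k) (Tf ?r))"
      using fnorm_scale[of "restr (E k) (Tf ?r)" "-1"] funs_restr[OF mem(3) Ek] by simp
    also have "fnorm (restr (E k) (Tf ?r)) \<le> \<epsilon> * fnorm ?r"
      using eq by (intro fnorm_restr_Tf_le r Ek) (auto simp: restr_apply)
    also have "\<epsilon> * fnorm ?r \<le> \<epsilon> * fnorm g"
      using eq by (intro mult_left_mono eps_nonneg fnorm_mono g) (auto simp: restr_apply)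
    also have "fnorm (restr (E k) (Tf g)) \<le> fnorm (Tf g)" by (intro fnorm_restr_le mem Ek)
    finally show ?thesis by simp
  qed
  then show ?thesis by blast
qed

section \<open>Good sets and their unions\<close>

text \<open>The bound is against the norm of \<open>f\<close> instead of that of
  \<open>restr S f\<close>; since restriction is idempotent and does not increase the norm, this is
  the same condition. Quantifying over all of \<open>funs\<close> avoids speaking of functions
  supported on \<open>S\<close>.\<close>

definition bound_on :: "'a set \<Rightarrow> real \<Rightarrow> bool" where
  "bound_on S K \<longleftrightarrow> 0 \<le> K \<and> (\<forall>f\<in>funs. fnorm (Tf (restr S f)) \<le> K * fnorm f)"

definition good_sets :: "'a set set" where
  "good_sets = {S \<in> sets M. \<exists>K. bound_on S K}"

text \<open>Gliding hump: functions violating the bounds, rescaled to norm at most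
  \<open>(1/2)^k\<close>, would have images of norm above \<open>k\<close>, although such images are
  uniformly bounded. The factor \<open>2^k\<close> pays for the rescaling and the factor
  \<open>k\<close> produces the unboundedness.\<close>

lemma bound_on_disjoint_sequence:
  fixes E :: "nat \<Rightarrow> 'a set"
  assumes E: "disjoint_family E" "range E \<subseteq> sets M"
  shows "\<exists>k. bound_on (E k) (real k * 2^k)"
proof (rule ccontr)
  assume "\<not> ?thesis"
  then have "\<forall>k. \<exists>f\<in>funs. real k * 2^k * fnorm f < fnorm (Tf (restr (E k) f))"
    by (auto simp: bound_on_def not_le)
  then obtain f where f: "\<And>k. f k \<in> funs"
    and big: "\<And>k. real k * 2^k * fnorm (f k) < fnorm (Tf (restr (E k) (f k)))" by metis
  have Ek: "E k \<in> sets M" for k using E by auto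
  \<comment> \<open>A function of norm 0 is null, so its restriction has an image of norm 0 and
    cannot violate the strict inequality \<open>big\<close>.\<close>
  have pos: "0 < fnorm (f k)" for k
  proof (rule ccontr)
    assume "\<not> ?thesis"
    then have "fnorm (f k) = 0" using fnorm_nonneg[OF f] by (simp add: order_antisym)
    then have "AE \<omega> in M. restr (E k) (f k) \<omega> = 0"
      using fnorm_eq_zero_iff[OF f, of k] by (auto simp: restr_apply)
    then have "fnorm (Tf (restr (E k) (f k))) = 0" by (intro Tf_null funs_restr f Ek)
    with big[of k] \<open>fnorm (f k) = 0\<close> show False by simp
  qed
  define c where "c k = (1/2)^k / fnorm (f k)" for k
  have c: "0 < c k" for k using pos by (simp add: c_def)
  define h where "h k = (\<lambda>\<omega>. c k * restr (E k) (f k) \<omega>)" for k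
  have "\<exists>C. \<forall>k. fnorm (Tf (h k)) \<le> C"
  proof (rule Tf_bounded_on_disjoint_sequence[OF E])
    show "h k \<in> funs" for k unfolding h_def by (intro funs_scale funs_restr f Ek)
    have "fnorm (h k) = c k * fnorm (restr (E k) (f k))" for k
      unfolding h_def using c[of k] by (simp add: fnorm_scale funs_restr f Ek)
    also have "\<dots> k \<le> c k * fnorm (f k)" for k
      using c[of k] by (intro mult_left_mono fnorm_restr_le f Ek) auto
    finally show "fnorm (h k) \<le> (1/2)^k" for k using pos by (simp add: c_def order_less_imp_not_eq2)
  qed (auto simp: h_def restr_apply)
  then obtain C where C: "\<And>k. fnorm (Tf (h k)) \<le> C" by blast
  have "real k < C" for k
  proof -
    have "real k = c k * (real k * 2^k * fnorm (f k))"
      using pos[of k] by (simp add: c_def power_one_over)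
    also have "\<dots> < c k * fnorm (Tf (restr (E k) (f k)))"
      using c big by (intro mult_strict_left_mono) auto
    also have "\<dots> = fnorm (Tf (h k))"
      unfolding h_def using c[of k] by (simp add: fnorm_Tf_scale funs_restr f Ek)
    finally show ?thesis using C[of k] by simp
  qed
  then show False using reals_Archimedean2[of C] by (meson less_asym)
qed

lemma bound_on_subset:
  assumes S: "S \<in> sets M" "S \<subseteq> S'" and b: "bound_on S' K"
  shows "bound_on S K"
  unfolding bound_on_def
proof (intro conjI ballI)
  fix f assume f: "f \<in> funs"
  have "restr S' (restr S f) = restr S f" using S(2) by (auto simp: restr_apply fun_eq_iff)
  then have "fnorm (Tf (restr S f)) \<le> K * fnorm (restr S f)"
    using b funs_restr[OF f S(1)] by (auto simp: bound_on_def)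
  also have "\<dots> \<le> K * fnorm f"
    using b by (intro mult_left_mono fnorm_restr_le f S) (auto simp: bound_on_def)
  finally show "fnorm (Tf (restr S f)) \<le> K * fnorm f" .
qed (use b in \<open>simp add: bound_on_def\<close>)

lemma bound_on_Un:
  assumes "S \<in> sets M" "S' \<in> sets M" "bound_on S K" "bound_on S' K'"
  shows "bound_on (S \<union> S') (K + K')"
  unfolding bound_on_def
proof (intro conjI ballI)
  show "0 \<le> K + K'" using assms by (simp add: bound_on_def)
  fix f assume f: "f \<in> funs"
  have co: "space M - S \<in> sets M" using assms by auto
  \<comment> \<open>The sets may overlap, so the second summand keeps only the part of
    \<open>S'\<close> outside \<open>S\<close>.\<close>
  have "fnorm (Tf (restr (S \<union> S') f)) \<le>
      fnorm (Tf (restr S f)) + fnorm (Tf (restr S' (restr (space M - S) f)))"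
    using assms(1,2) co f
    by (intro fnorm_Tf_add_le funs_restr) (auto simp: restr_apply intro!: AE_I2)
  also have "\<dots> \<le> K * fnorm f + K' * fnorm (restr (space M - S) f)"
    using assms(3,4) f co by (intro add_mono) (auto simp: bound_on_def funs_restr)
  also have "\<dots> \<le> K * fnorm f + K' * fnorm f"
    using assms(4) f co by (intro add_left_mono mult_left_mono fnorm_restr_le) (auto simp: bound_on_def)
  finally show "fnorm (Tf (restr (S \<union> S') f)) \<le> (K + K') * fnorm f" by (simp add: algebra_simps)
qed

lemma good_sets_Un: "S \<in> good_sets \<Longrightarrow> S' \<in> good_sets \<Longrightarrow> S \<union> S' \<in> good_sets"
  using bound_on_Un by (auto simp: good_sets_def) blast

lemma null_sets_good: "S \<in> null_sets M \<Longrightarrow> S \<in> good_sets"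
proof -
  assume S: "S \<in> null_sets M"
  have "bound_on S 0" unfolding bound_on_def
  proof (intro conjI ballI)
    fix f assume f: "f \<in> funs"
    have "AE \<omega> in M. restr S f \<omega> = 0"
      using AE_not_in[OF S] by eventually_elim (simp add: restr_apply)
    then show "fnorm (Tf (restr S f)) \<le> 0 * fnorm f"
      using Tf_null[OF funs_restr[OF f]] S by auto
  qed simp
  then show ?thesis using S by (auto simp: good_sets_def)
qed

lemma uniform_bound_on_incseq_Union:
  assumes D: "range D \<subseteq> sets M" "incseq D" and K: "\<And>n. bound_on (D n) K"
  shows "\<exists>K. bound_on (\<Union>n. D n) K"
proof -
  obtain c where c: "0 \<le> c"
    "\<And>D f K. \<lbrakk>range D \<subseteq> sets M; incseq D; f \<in> funs; \<And>n. fnorm (restr (D n) f) \<le> K\<rbrakk>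
      \<Longrightarrow> fnorm (restr (\<Union>n. D n) f) \<le> c * K"
    using fatou_increasing_restr[OF fatou] by blast
  define U where "U = (\<Union>n. D n)"
  have U: "U \<in> sets M" "space M - U \<in> sets M" and Dn: "D n \<in> sets M" "U - D n \<in> sets M" for n
    using D(1) by (auto simp: U_def)
  have K0: "0 \<le> K" using K by (simp add: bound_on_def)
  have "fnorm (Tf (restr U f)) \<le> (c * (K + \<epsilon>) + \<epsilon>) * fnorm f" if f: "f \<in> funs" for f
  proof -
    define g where "g = Tf (restr U f)"
    have g: "g \<in> funs" unfolding g_def by (intro Tf_mem funs_restr f U)
    have "fnorm (restr (D n) g) \<le> (K + \<epsilon>) * fnorm f" for n
    proof -
      let ?a = "restr (D n) f" and ?b = "restr (U - D n) f"
      have ab: "?a \<in> funs" "?b \<in> funs" by (intro funs_restr f Dn)+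
      have "restr U f = (\<lambda>\<omega>. ?a \<omega> + ?b \<omega>)" by (auto simp: restr_apply U_def)
      then have "AE \<omega> in M. g \<omega> = Tf ?a \<omega> + Tf ?b \<omega>" unfolding g_def using Tf_add[OF ab] by simp
      then have "fnorm (restr (D n) g) \<le> fnorm (restr (D n) (Tf ?a)) + fnorm (restr (D n) (Tf ?b))"
        by (intro fnorm_add_le restr_measurable funs_measurable[OF g] funs_restr Tf_mem ab Dn)
          (auto simp: restr_apply)
      also have "fnorm (restr (D n) (Tf ?a)) \<le> fnorm (Tf ?a)"
        by (intro fnorm_restr_le Tf_mem ab Dn)
      also have "fnorm (Tf ?a) \<le> K * fnorm f" using K f by (simp add: bound_on_def)
      also have "fnorm (restr (D n) (Tf ?b)) \<le> \<epsilon> * fnorm ?b"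
        by (intro fnorm_restr_Tf_le ab Dn) (auto simp: restr_apply)
      also have "\<epsilon> * fnorm ?b \<le> \<epsilon> * fnorm f"
        by (intro mult_left_mono fnorm_restr_le f Dn eps_nonneg)
      finally show ?thesis by (simp add: algebra_simps)
    qed
    then have 1: "fnorm (restr U g) \<le> c * ((K + \<epsilon>) * fnorm f)"
      unfolding U_def by (intro c(2) D g)
    have "fnorm (restr (space M - U) g) \<le> \<epsilon> * fnorm (restr U f)"
      unfolding g_def by (intro fnorm_restr_Tf_le funs_restr f U) (auto simp: restr_apply)
    also have "\<dots> \<le> \<epsilon> * fnorm f" by (intro mult_left_mono fnorm_restr_le f U eps_nonneg)
    finally have 2: "fnorm (restr (space M - U) g) \<le> \<epsilon> * fnorm f" .
    have "fnorm g \<le> fnorm (restr U g) + fnorm (restr (space M - U) g)"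
      by (intro fnorm_add_le funs_measurable[OF g] funs_restr g U)
        (auto simp: restr_apply intro!: AE_I2)
    with 1 2 show ?thesis by (simp add: g_def algebra_simps)
  qed
  moreover have "0 \<le> c * (K + \<epsilon>) + \<epsilon>" using c(1) K0 eps_nonneg by simp
  ultimately show ?thesis by (auto simp: bound_on_def U_def)
qed

text \<open>Without a uniform bound on the \<open>D n\<close>, the increments between suitable
  members would form a disjoint sequence violating every bound \<open>k * 2^k\<close>. With a
  uniform bound, \<open>uniform_bound_on_incseq_Union\<close> applies.\<close>

lemma good_sets_incseq_Union:
  fixes D :: "nat \<Rightarrow> 'a set"
  assumes D: "range D \<subseteq> good_sets" "incseq D"
  shows "(\<Union>n. D n) \<in> good_sets"
proof -
  have Dm: "D n \<in> sets M" for n using D(1) by (auto simp: good_sets_def)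
  have "\<exists>K. \<forall>n. bound_on (D n) K"
  proof (rule ccontr)
    assume no: "\<not> ?thesis"
    have "\<exists>n>m. \<not> bound_on (D n - D m) (real k * 2^k)" for m k
    proof -
      obtain K where K: "bound_on (D m) K" using D(1) by (auto simp: good_sets_def)
      \<comment> \<open>Adding the known bound \<open>K\<close> of \<open>D m\<close> ensures that
        the failure is due to the increment \<open>D n - D m\<close>. It also forces
        \<open>m < n\<close>, since a subset of \<open>D m\<close> inherits the bound
        \<open>K\<close>.\<close>
      obtain n where n: "\<not> bound_on (D n) (K + real k * 2^k)" using no by blast
      have nb: "\<not> bound_on (D n - D m) (real k * 2^k)"
      proof
        assume "bound_on (D n - D m) (real k * 2^k)"
        then have "bound_on (D m \<union> (D n - D m)) (K + real k * 2^k)"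
          using Dm K by (intro bound_on_Un) auto
        then have "bound_on (D n) (K + real k * 2^k)"
          by (rule bound_on_subset[rotated 2]) (use Dm in auto)
        with n show False ..
      qed
      moreover have "m < n"
      proof (rule ccontr)
        assume "\<not> m < n"
        then have "D n \<subseteq> D m" using D(2) by (auto simp: incseq_def)
        then have "bound_on (D n) K" by (rule bound_on_subset[OF Dm _ K])
        then have "bound_on (D n) (K + real k * 2^k)"
          by (simp add: bound_on_def distrib_right add_increasing2 fnorm_nonneg)
        with n show False ..
      qed
      ultimately show ?thesis by blast
    qed
    then obtain nx where nx: "\<And>m k. m < nx m k" "\<And>m k. \<not> bound_on (D (nx m k) - D m) (real k * 2^k)"
      by metis
    \<comment> \<open>The recursion hands the step number \<open>k\<close> to \<open>nx\<close>, so
      that the \<open>k\<close>-th increment violates exactly the \<open>k\<close>-th bound.\<close>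
    define p where "p = rec_nat 0 (\<lambda>k m. nx m k)"
    have p: "p (Suc k) = nx (p k) k" for k by (simp add: p_def)
    have "mono p" using nx(1) by (simp add: mono_iff_le_Suc p less_imp_le)
    define E where "E k = D (p (Suc k)) - D (p k)" for k
    have "E i \<inter> E j = {}" if "i < j" for i j
    proof -
      have "p (Suc i) \<le> p j" using \<open>mono p\<close> that by (simp add: monoD Suc_leI)
      then have "D (p (Suc i)) \<subseteq> D (p j)" using D(2) by (auto simp: incseq_def)
      then show ?thesis by (auto simp: E_def)
    qed
    then have "disjoint_family E" unfolding disjoint_family_on_def
      by (metis inf_commute linorder_neqE_nat)
    moreover have "range E \<subseteq> sets M" using Dm by (auto simp: E_def)
    ultimately obtain k where "bound_on (E k) (real k * 2^k)"
      using bound_on_disjoint_sequence by blast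
    then show False using nx(2) by (simp add: E_def p)
  qed
  then show ?thesis
    using uniform_bound_on_incseq_Union[of D] D(2) Dm by (auto simp: good_sets_def)
qed

section \<open>Bad sets and atoms\<close>

text \<open>Otherwise every bad subset of \<open>R\<close> splits into two bad pieces. Splitting one
  piece again and again and setting the other aside yields a disjoint sequence of bad sets, contrary
  to \<open>bound_on_disjoint_sequence\<close>.\<close>

lemma exists_unsplittable_bad_set:
  assumes R: "R \<in> sets M" "R \<notin> good_sets"
  obtains B where "B \<in> sets M" "B \<subseteq> R" "B \<notin> good_sets"
    "\<And>S. S \<in> sets M \<Longrightarrow> S \<subseteq> B \<Longrightarrow> S \<in> good_sets \<or> B - S \<in> good_sets"
proof (rule ccontr)
  note thesisI = that
  assume no: "\<not> thesis"
  have split: "\<exists>S. S \<in> sets M \<and> S \<subseteq> B \<and> S \<notin> good_sets \<and> B - S \<notin> good_sets"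
    if B: "B \<in> sets M" "B \<subseteq> R" "B \<notin> good_sets" for B
  proof (rule ccontr)
    assume "\<not> ?thesis"
    then have thesis by (intro thesisI[OF B]) blast
    with no show False ..
  qed
  define P where "P B \<longleftrightarrow> B \<in> sets M \<and> B \<subseteq> R \<and> B \<notin> good_sets" for B
  have "\<exists>B. \<forall>n. P (B n) \<and> (B (Suc n) \<subseteq> B n \<and> B n - B (Suc n) \<notin> good_sets)"
  proof (rule dependent_nat_choice)
    show "\<exists>B. P B" using R by (auto simp: P_def)
    show "\<exists>S. P S \<and> (S \<subseteq> B \<and> B - S \<notin> good_sets)" if "P B" for B
      using split[of B] that unfolding P_def by (meson order_trans)
  qed
  then obtain B :: "nat \<Rightarrow> 'a set" where B: "\<And>n. P (B n)" "\<And>n. B (Suc n) \<subseteq> B n"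
    "\<And>n. B n - B (Suc n) \<notin> good_sets" by blast
  define E where "E n = B n - B (Suc n)" for n
  have "decseq B" using B(2) by (rule decseq_SucI)
  have "E i \<inter> E j = {}" if "i < j" for i j
    using decseqD[OF \<open>decseq B\<close>, of "Suc i" j] that by (auto simp: E_def)
  then have "disjoint_family E" unfolding disjoint_family_on_def
    by (metis inf_commute linorder_neqE_nat)
  moreover have "range E \<subseteq> sets M" using B(1) by (auto simp: E_def P_def)
  ultimately obtain k where "bound_on (E k) (real k * 2^k)"
    using bound_on_disjoint_sequence by blast
  then show False using B(3)[of k] \<open>range E \<subseteq> sets M\<close> by (auto simp: good_sets_def E_def)
qed

lemma atom_good:
  assumes B: "B \<in> sets M"
    and atom: "\<And>S. S \<in> sets M \<Longrightarrow> S \<subseteq> B \<Longrightarrow> S \<in> null_sets M \<or> B - S \<in> null_sets M"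
  shows "B \<in> good_sets"
\<comment> \<open>Either all restrictions to \<open>B\<close> are null, or one of them,
  \<open>g\<close>, is nonzero and every other restriction is almost everywhere a multiple of
  it.\<close>
proof (cases "\<exists>f0\<in>funs. fnorm (restr B f0) \<noteq> 0")
  case False
  have "fnorm (Tf (restr B f)) \<le> 0 * fnorm f" if "f \<in> funs" for f
    using Tf_null[OF funs_restr[OF that B]] fnorm_eq_zero_iff[OF funs_restr[OF that B]] False that
    by auto
  then show ?thesis using B by (auto simp: good_sets_def bound_on_def)
next
  case True
  then obtain f0 where f0: "f0 \<in> funs" and "fnorm (restr B f0) \<noteq> 0" by blast
  define g where "g = restr B f0"
  have g: "g \<in> funs" unfolding g_def by (intro funs_restr f0 B)
  have gpos: "0 < fnorm g"
    using fnorm_nonneg[OF g] \<open>fnorm (restr B f0) \<noteq> 0\<close> by (simp add: g_def)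
  obtain c0 where c0: "AE \<omega> in M. \<omega> \<in> B \<longrightarrow> f0 \<omega> = c0"
    using AE_constant_on_atom[OF B funs_measurable[OF f0] atom] by blast
  have "c0 \<noteq> 0"
  proof
    assume "c0 = 0"
    then have "AE \<omega> in M. g \<omega> = 0" using c0 by (auto simp: g_def restr_apply)
    then show False using gpos fnorm_eq_zero_iff[OF g] by simp
  qed
  \<comment> \<open>On the line spanned by \<open>g\<close> the image norm is exactly this multiple
    of the norm.\<close>
  define K where "K = fnorm (Tf g) / fnorm g"
  have "fnorm (Tf (restr B f)) \<le> K * fnorm f" if f: "f \<in> funs" for f
  proof -
    obtain c where c: "AE \<omega> in M. \<omega> \<in> B \<longrightarrow> f \<omega> = c"
      using AE_constant_on_atom[OF B funs_measurable[OF f] atom] by blast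
    define a where "a = c / c0"
    have eq: "AE \<omega> in M. restr B f \<omega> = a * g \<omega>"
      using c c0 by eventually_elim (use \<open>c0 \<noteq> 0\<close> in \<open>auto simp: a_def g_def restr_apply\<close>)
    have "Tf (restr B f) = Tf (\<lambda>\<omega>. a * g \<omega>)"
      using eq by (intro Tf_cong funs_restr funs_scale f g B)
    then have "fnorm (Tf (restr B f)) = K * (\<bar>a\<bar> * fnorm g)"
      using gpos by (simp add: fnorm_Tf_scale g K_def)
    also have "\<bar>a\<bar> * fnorm g = fnorm (\<lambda>\<omega>. a * g \<omega>)" by (simp add: fnorm_scale g)
    also have "K * \<dots> \<le> K * fnorm f"
    proof (rule mult_left_mono)
      have "fnorm (\<lambda>\<omega>. a * g \<omega>) \<le> fnorm (restr B f)"
        using eq by (intro fnorm_mono funs_restr f B funs_measurable[OF funs_scale[OF g]]) auto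
      also have "\<dots> \<le> fnorm f" by (intro fnorm_restr_le f B)
      finally show "fnorm (\<lambda>\<omega>. a * g \<omega>) \<le> fnorm f" .
      show "0 \<le> K" unfolding K_def by (intro divide_nonneg_nonneg fnorm_nonneg Tf_mem g)
    qed
    finally show ?thesis .
  qed
  moreover have "0 \<le> K" unfolding K_def by (intro divide_nonneg_nonneg fnorm_nonneg Tf_mem g)
  ultimately show ?thesis using B by (auto simp: good_sets_def bound_on_def)
qed

text \<open>Outside a maximal good set \<open>D\<close>, good sets are null. A bad set there that
  does not split into two bad ones would thus be an atom, and \<open>atom_good\<close> would make it
  good.\<close>

lemma space_good: "space M \<in> good_sets"
proof -
  have "{} \<in> good_sets" by (rule null_sets_good) simp
  then have ne: "good_sets \<noteq> {}" by blast
  have sub: "good_sets \<subseteq> sets M" by (auto simp: good_sets_def)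
  obtain D where D: "D \<in> good_sets"
    and max: "\<And>S. S \<in> good_sets \<Longrightarrow> S \<inter> D = {} \<Longrightarrow> S \<in> null_sets M"
    using exists_maximal_set[OF sub ne good_sets_Un good_sets_incseq_Union] by blast
  have "D \<in> sets M" using D sub by blast
  have "space M - D \<in> good_sets"
  proof (rule ccontr)
    assume "space M - D \<notin> good_sets"
    then obtain B where B: "B \<in> sets M" "B \<subseteq> space M - D" "B \<notin> good_sets"
      and unsplit: "\<And>S. S \<in> sets M \<Longrightarrow> S \<subseteq> B \<Longrightarrow> S \<in> good_sets \<or> B - S \<in> good_sets"
      using exists_unsplittable_bad_set[of "space M - D"] \<open>D \<in> sets M\<close> by blast
    have "S \<in> null_sets M \<or> B - S \<in> null_sets M" if "S \<in> sets M" "S \<subseteq> B" for S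
      using unsplit[OF that] max[of S] max[of "B - S"] B(2) that(2) by blast
    then have "B \<in> good_sets" by (intro atom_good B)
    with B(3) show False ..
  qed
  then have "D \<union> (space M - D) \<in> good_sets" by (intro good_sets_Un D)
  moreover have "D \<union> (space M - D) = space M" using sets.sets_into_space[OF \<open>D \<in> sets M\<close>] by auto
  ultimately show ?thesis by simp
qed

section \<open>From the global bound to continuity\<close>

lemma Tf_bounded: "\<exists>K\<ge>0. \<forall>f\<in>funs. fnorm (Tf f) \<le> K * fnorm f"
proof -
  obtain K where K: "bound_on (space M) K" using space_good by (auto simp: good_sets_def)
  have "fnorm (Tf f) \<le> K * fnorm f" if f: "f \<in> funs" for f
  proof -
    have "Tf (restr (space M) f) = Tf f"
      by (intro Tf_cong funs_restr f) (auto simp: restr_apply intro!: AE_I2)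
    then show ?thesis using K f by (auto simp: bound_on_def)
  qed
  then show ?thesis using K by (auto simp: bound_on_def)
qed

lemma continuous_map_koethe_topology:
  "continuous_map (koethe_topology M X N) (koethe_topology M X N) T"
proof -
  interpret d: Metric_space X "koethe_dist M X N" by (rule Metric_space_koethe_dist)
  obtain K where K0: "0 \<le> K" and K: "\<And>f. f \<in> funs \<Longrightarrow> fnorm (Tf f) \<le> K * fnorm f"
    using Tf_bounded by blast
  have lip: "koethe_dist M X N (T A) (T B) \<le> K * koethe_dist M X N A B"
    if "A \<in> X" "B \<in> X" for A B
  proof -
    obtain f g where f: "f \<in> funs" "A = ae_class M f" and g: "g \<in> funs" "B = ae_class M g"
      using \<open>A \<in> X\<close> \<open>B \<in> X\<close> by (metis mem_carrier_E)
    let ?h = "\<lambda>\<omega>. f \<omega> - g \<omega>"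
    have h: "?h \<in> funs" by (intro funs_diff f g)
    have "AE \<omega> in M. Tf f \<omega> = Tf ?h \<omega> + Tf g \<omega>" using Tf_add[OF h g(1)] by simp
    then have "fnorm (\<lambda>\<omega>. Tf f \<omega> - Tf g \<omega>) \<le> fnorm (Tf ?h)"
      by (intro fnorm_mono Tf_mem h funs_measurable[OF funs_diff] f g) auto
    also have "\<dots> \<le> K * fnorm ?h" by (rule K[OF h])
    finally show ?thesis
      by (simp add: f g koethe_dist_ae_class Tf_mem flip: ae_class_Tf)
  qed
  have TX: "T ` X \<subseteq> X" using linear by (auto simp: koethe_linear_def)
  have "\<exists>\<delta>>0. \<forall>B. B \<in> X \<and> koethe_dist M X N A B < \<delta> \<longrightarrow> koethe_dist M X N (T A) (T B) < e"
    if "A \<in> X" "0 < e" for A e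
  \<comment> \<open>The summand 1 keeps the denominator positive when \<open>K\<close> is 0.\<close>
  proof (intro exI[of _ "e / (K + 1)"] conjI allI impI)
    show "0 < e / (K + 1)" using that K0 by simp
    fix B assume B: "B \<in> X \<and> koethe_dist M X N A B < e / (K + 1)"
    have "koethe_dist M X N (T A) (T B) \<le> K * koethe_dist M X N A B" using lip that B by blast
    also have "\<dots> \<le> (K + 1) * koethe_dist M X N A B" by (intro mult_right_mono) auto
    also have "\<dots> < e" using B K0 by (simp add: pos_less_divide_eq mult.commute)
    finally show "koethe_dist M X N (T A) (T B) < e" .
  qed
  then show ?thesis
    unfolding koethe_topology_def d.metric_continuous_map[OF Metric_space_koethe_dist]
    using TX by blast
qed

end

theorem proposition3p1:
  fixes M :: "'a measure"
    and X :: "('a \<Rightarrow> real) set set"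
    and N :: "('a \<Rightarrow> real) set \<Rightarrow> real"
    and T :: "('a \<Rightarrow> real) set \<Rightarrow> ('a \<Rightarrow> real) set"
    and \<epsilon> :: real
  assumes "koethe_function_space M X N"
    and "koethe_fatou_norm M X N"
    and "0 \<le> \<epsilon>"
    and "koethe_linear M X T"
    and "band_preserving_upto M X N \<epsilon> T"
  shows "continuous_map (koethe_topology M X N) (koethe_topology M X N) T"
proof -
  interpret almost_band_preserving M X N T \<epsilon>
    using assms by (intro almost_band_preserving.intro almost_band_preserving_axioms.intro)
  show ?thesis by (rule continuous_map_koethe_topology)
qed

end
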